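(* Let $f(q)=q+\sum_{k=2}^{\infty}q^kp_k$ (with $p_k\in\mathbb{H}$) be a slice regular function on $\mathbb{B}$ such that the function $q\mapsto qf'(q)$ belongs to $\mathcal{S}^*$. Then $$|q|+\sum_{k=2}^{\infty}|q^kp_k|\leq 1\quad\text{for all } q\in\mathbb{B}\text{ with } |q|\leq \frac12.$$ The constant $1/2$ cannot be improved, i.e. it cannot be replaced by any larger number so that the inequality remains true for all such $f$.
   Context: $\mathbb{H}$ is the skew field of quaternions with its usual modulus $|\cdot|$ and real part $\mathrm{Re}$; $\mathbb{B}=\{q\in\mathbb{H}:|q|<1\}$. Let $\mathbb{S}=\{q\in\mathbb{H}:q^2=-1\}$ and, for $I\in\mathbb{S}$, $\mathbb{C}_I=\mathbb{R}\oplus I\mathbb{R}$ and $\mathbb{B}_I=\mathbb{B}\cap\mathbb{C}_I$. A function $f:\mathbb{B}\to\mathbb{H}$ is (left) slice regular if for every $I\in\mathbb{S}$ its restriction $f_I$ to $\mathbb{B}_I$ has continuous partial derivatives and satisfies $\frac12\left(\frac{\partial}{\partial x}+I\frac{\partial}{\partial y}\right)f_I(x+yI)=0$ for all $x+yI\in\mathbb{B}_I$. Every slice regular $f$ on $\mathbb{B}$ has a power series expansion $f(q)=\sum_{k=0}^\infty q^kp_k$ on $\mathbb{B}$ with $p_k\in\mathbb{H}$. The slice derivative $f'$ is defined on each $\mathbb{B}_I$ by $f'(x+yI)=\frac12\left(\frac{\partial}{\partial x}-I\frac{\partial}{\partial y}\right)f_I(x+yI)$. $\mathcal{S}$ denotes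 the class of slice regular functions $g$ on $\mathbb{B}$ with $g(0)=0$, $g'(0)=1$, and whose zero set in $\mathbb{B}$ is exactly $\{0\}$. The class of slice starlike functions is $$\mathcal{S}^*=\{g\in\mathcal{S}:\ \mathrm{Re}\left(g(q)^{-1}qg'(q)\right)>0\ \text{on}\ \mathbb{B}\},$$ where at $q=0$ the expression $g(q)^{-1}qg'(q)$ is understood as its limit, $1$. *)

theory Defs
  imports "HOL-Analysis.Analysis"
begin

section \<open>The skew field of quaternions\<close>

text \<open>
  \<open>Quat a b c d\<close> stands for \<open>a + b i + c j + d k\<close>. The instances below end in
  \<^class>\<open>real_normed_div_algebra\<close> and \<^class>\<open>euclidean_space\<close>; the norm is the usual modulus,
  and \<^const>\<open>of_real\<close> is the embedding of the reals.
\<close>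

datatype quat = Quat (qRe: real) (qI: real) (qJ: real) (qK: real)

lemma quat_eq_iff: "x = y \<longleftrightarrow> qRe x = qRe y \<and> qI x = qI y \<and> qJ x = qJ y \<and> qK x = qK y"
  by (cases x; cases y) auto

instantiation quat :: real_vector
begin

definition zero_quat :: quat where "0 = Quat 0 0 0 0"

definition plus_quat :: "quat \<Rightarrow> quat \<Rightarrow> quat" where
  "x + y = Quat (qRe x + qRe y) (qI x + qI y) (qJ x + qJ y) (qK x + qK y)"

definition uminus_quat :: "quat \<Rightarrow> quat" where
  "- x = Quat (- qRe x) (- qI x) (- qJ x) (- qK x)"

definition minus_quat :: "quat \<Rightarrow> quat \<Rightarrow> quat" where
  "x - y = Quat (qRe x - qRe y) (qI x - qI y) (qJ x - qJ y) (qK x - qK y)"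

definition scaleR_quat :: "real \<Rightarrow> quat \<Rightarrow> quat" where
  "r *\<^sub>R x = Quat (r * qRe x) (r * qI x) (r * qJ x) (r * qK x)"

instance
  by standard
    (simp_all add: quat_eq_iff zero_quat_def plus_quat_def uminus_quat_def minus_quat_def
      scaleR_quat_def algebra_simps)

end

instantiation quat :: real_algebra_1
begin

definition one_quat :: quat where "1 = Quat 1 0 0 0"

definition times_quat :: "quat \<Rightarrow> quat \<Rightarrow> quat" where
  "x * y = Quat
     (qRe x * qRe y - qI x * qI y - qJ x * qJ y - qK x * qK y)
     (qRe x * qI y + qI x * qRe y + qJ x * qK y - qK x * qJ y)
     (qRe x * qJ y - qI x * qK y + qJ x * qRe y + qK x * qI y)
     (qRe x * qK y + qI x * qJ y - qJ x * qI y + qK x * qRe y)"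

instance
  by standard
    (simp_all add: quat_eq_iff zero_quat_def plus_quat_def one_quat_def times_quat_def
      scaleR_quat_def algebra_simps)

end

instantiation quat :: real_div_algebra
begin

definition inverse_quat :: "quat \<Rightarrow> quat" where
  "inverse x =
     (1 / ((qRe x)\<^sup>2 + (qI x)\<^sup>2 + (qJ x)\<^sup>2 + (qK x)\<^sup>2)) *\<^sub>R Quat (qRe x) (- qI x) (- qJ x) (- qK x)"

definition divide_quat :: "quat \<Rightarrow> quat \<Rightarrow> quat" where "x div (y::quat) = x * inverse y"

instance
proof
  fix x y :: quat
  show "inverse (0::quat) = 0"
    by (simp add: inverse_quat_def zero_quat_def scaleR_quat_def)
  show "x div y = x * inverse y"
    by (simp add: divide_quat_def)
  define n where "n = (qRe x)\<^sup>2 + (qI x)\<^sup>2 + (qJ x)\<^sup>2 + (qK x)\<^sup>2"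
  assume "x \<noteq> 0"
  then have "n \<noteq> 0"
    by (auto simp: n_def quat_eq_iff zero_quat_def add_nonneg_eq_0_iff)
  define c where "c = Quat (qRe x) (- qI x) (- qJ x) (- qK x)"
  have "c * x = n *\<^sub>R 1" "x * c = n *\<^sub>R 1"
    by (simp_all add: c_def n_def quat_eq_iff times_quat_def one_quat_def scaleR_quat_def
        power2_eq_square)
  moreover have "inverse x = (1 / n) *\<^sub>R c"
    by (simp add: inverse_quat_def n_def c_def)
  ultimately show "inverse x * x = 1" "x * inverse x = 1"
    using \<open>n \<noteq> 0\<close> by simp_all
qed

end

instantiation quat :: real_inner
begin

definition inner_quat :: "quat \<Rightarrow> quat \<Rightarrow> real" where
  "inner x y = qRe x * qRe y + qI x * qI y + qJ x * qJ y + qK x * qK y"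

definition norm_quat :: "quat \<Rightarrow> real" where
  "norm x = sqrt ((qRe x)\<^sup>2 + (qI x)\<^sup>2 + (qJ x)\<^sup>2 + (qK x)\<^sup>2)"

definition sgn_quat :: "quat \<Rightarrow> quat" where "sgn (x::quat) = x /\<^sub>R norm x"

definition dist_quat :: "quat \<Rightarrow> quat \<Rightarrow> real" where "dist (x::quat) y = norm (x - y)"

definition uniformity_quat :: "(quat \<times> quat) filter" where
  "uniformity = (INF e\<in>{0 <..}. principal {(x::quat, y). dist x y < e})"

definition open_quat :: "quat set \<Rightarrow> bool" where
  "open (U::quat set) \<longleftrightarrow> (\<forall>x\<in>U. eventually (\<lambda>(x', y). x' = x \<longrightarrow> y \<in> U) uniformity)"

instance
proof
  fix x y z :: quat and r :: real and U :: "quat set"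
  show "dist x y = norm (x - y)"
    by (rule dist_quat_def)
  show "sgn (x::quat) = x /\<^sub>R norm x"
    by (rule sgn_quat_def)
  show "uniformity = (INF e\<in>{0 <..}. principal {(x, y). dist x (y::quat) < e})"
    by (rule uniformity_quat_def)
  show "open U \<longleftrightarrow> (\<forall>x\<in>U. eventually (\<lambda>(x', y). x' = x \<longrightarrow> y \<in> U) uniformity)"
    by (rule open_quat_def)
  show "inner x y = inner y x"
    by (simp add: inner_quat_def mult.commute)
  show "inner (x + y) z = inner x z + inner y z"
    by (simp add: inner_quat_def plus_quat_def algebra_simps)
  show "inner (r *\<^sub>R x) y = r * inner x y"
    by (simp add: inner_quat_def scaleR_quat_def algebra_simps)
  show "0 \<le> inner x x"
    by (simp add: inner_quat_def)
  show "inner x x = 0 \<longleftrightarrow> x = 0"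
    by (simp add: inner_quat_def quat_eq_iff zero_quat_def add_nonneg_eq_0_iff)
  show "norm x = sqrt (inner x x)"
    by (simp add: inner_quat_def norm_quat_def power2_eq_square)
qed

end

instance quat :: real_normed_div_algebra
proof
  fix x y :: quat
  show "norm (x * y) = norm x * norm y"
    unfolding norm_quat_def real_sqrt_mult[symmetric]
  proof (rule arg_cong[where f = sqrt])
    show "(qRe (x * y))\<^sup>2 + (qI (x * y))\<^sup>2 + (qJ (x * y))\<^sup>2 + (qK (x * y))\<^sup>2 =
        ((qRe x)\<^sup>2 + (qI x)\<^sup>2 + (qJ x)\<^sup>2 + (qK x)\<^sup>2) *
        ((qRe y)\<^sup>2 + (qI y)\<^sup>2 + (qJ y)\<^sup>2 + (qK y)\<^sup>2)"
      unfolding times_quat_def quat.sel by algebra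
  qed
qed

instantiation quat :: euclidean_space
begin

definition Basis_quat :: "quat set" where
  "Basis = {Quat 1 0 0 0, Quat 0 1 0 0, Quat 0 0 1 0, Quat 0 0 0 1}"

instance
proof
  fix u v x :: quat
  show "(Basis :: quat set) \<noteq> {}" "finite (Basis :: quat set)"
    by (simp_all add: Basis_quat_def)
  show "inner u v = (if u = v then 1 else 0)" if "u \<in> Basis" "v \<in> Basis"
    using that unfolding Basis_quat_def by (elim insertE emptyE) (simp_all add: inner_quat_def)
  show "(\<forall>u\<in>Basis. inner x u = 0) \<longleftrightarrow> x = 0"
    unfolding Basis_quat_def by (simp add: inner_quat_def quat_eq_iff[of x] zero_quat_def)
qed

end


section \<open>Slice regular functions\<close>

definition unit_ball :: "quat set"  (\<open>\<bool>\<close>) where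
  "unit_ball = {q. norm q < 1}"

definition imag_units :: "quat set"  (\<open>\<S>\<close>) where
  "imag_units = {I. I\<^sup>2 = - 1}"

definition slice_point :: "quat \<Rightarrow> real \<Rightarrow> real \<Rightarrow> quat" where
  "slice_point I x y = of_real x + of_real y * I"

definition partial_x :: "(quat \<Rightarrow> quat) \<Rightarrow> quat \<Rightarrow> real \<Rightarrow> real \<Rightarrow> quat" where
  "partial_x f I x y = vector_derivative (\<lambda>t. f (slice_point I t y)) (at x)"

definition partial_y :: "(quat \<Rightarrow> quat) \<Rightarrow> quat \<Rightarrow> real \<Rightarrow> real \<Rightarrow> quat" where
  "partial_y f I x y = vector_derivative (\<lambda>t. f (slice_point I x t)) (at y)"

text \<open>
  Functions on the ball are modelled by total functions whose values outside the ball are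
  irrelevant: the slices of the ball are relatively open, so the partial derivatives at their
  points do not see those values.
\<close>

definition slice_C1 :: "(quat \<Rightarrow> quat) \<Rightarrow> quat \<Rightarrow> bool" where
  "slice_C1 f I \<longleftrightarrow>
     (\<forall>x y. slice_point I x y \<in> \<bool> \<longrightarrow>
        (\<lambda>t. f (slice_point I t y)) differentiable (at x) \<and>
        (\<lambda>t. f (slice_point I x t)) differentiable (at y)) \<and>
     continuous_on {(x, y). slice_point I x y \<in> \<bool>} (\<lambda>(x, y). partial_x f I x y) \<and>
     continuous_on {(x, y). slice_point I x y \<in> \<bool>} (\<lambda>(x, y). partial_y f I x y)"

definition slice_regular :: "(quat \<Rightarrow> quat) \<Rightarrow> bool" where
  "slice_regular f \<longleftrightarrow>
     (\<forall>I\<in>\<S>. slice_C1 f I \<and>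
        (\<forall>x y. slice_point I x y \<in> \<bool> \<longrightarrow>
           (1/2) *\<^sub>R (partial_x f I x y + I * partial_y f I x y) = 0))"

text \<open>
  A non-real point lies on one slice, parametrised by two opposite units; a real point lies on
  all slices. For slice regular functions the value below does not depend on the choice of the
  unit.
\<close>

definition slice_deriv :: "(quat \<Rightarrow> quat) \<Rightarrow> quat \<Rightarrow> quat" where
  "slice_deriv f q =
     (THE d. \<forall>I\<in>\<S>. \<forall>x y. q = slice_point I x y \<longrightarrow>
        d = (1/2) *\<^sub>R (partial_x f I x y - I * partial_y f I x y))"


section \<open>Slice starlike functions\<close>

definition class_S :: "(quat \<Rightarrow> quat) set" where
  "class_S =
     {g. slice_regular g \<and> g 0 = 0 \<and> slice_deriv g 0 = 1 \<and> {q \<in> \<bool>. g q = 0} = {0}}"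

text \<open>The value at 0 is the limit of the quotient there.\<close>

definition starlike_quotient :: "(quat \<Rightarrow> quat) \<Rightarrow> quat \<Rightarrow> quat" where
  "starlike_quotient g q = (if q = 0 then 1 else inverse (g q) * q * slice_deriv g q)"

definition slice_starlike :: "(quat \<Rightarrow> quat) set" where
  "slice_starlike = {g \<in> class_S. \<forall>q\<in>\<bool>. qRe (starlike_quotient g q) > 0}"

text \<open>
  \<open>f\<close> is slice regular on the ball with expansion \<open>f(q) = q + (\<Sum>k\<ge>2. q^k p\<^sub>k)\<close>, and
  \<open>q f'(q)\<close> is slice starlike. The coefficients \<open>p 0\<close> and \<open>p 1\<close> play no role.
\<close>

definition admissible :: "(quat \<Rightarrow> quat) \<Rightarrow> (nat \<Rightarrow> quat) \<Rightarrow> bool" where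
  "admissible f p \<longleftrightarrow>
     slice_regular f \<and>
     (\<forall>q\<in>\<bool>. (\<lambda>k. q ^ (k + 2) * p (k + 2)) sums (f q - q)) \<and>
     (\<lambda>q. q * slice_deriv f q) \<in> slice_starlike"

end

(*
  Write q f'(q) = q B(q) with coefficients b_n = (n + 1) p_(n+1), and let C have coefficients
  (n + 1) b_n. Starlikeness says that B has no zeros and that Re (B(q)^-1 C(q)) > 0. The pointwise
  quotient is not slice regular, but the star quotient P, defined by B * P = C, is, and it takes the same
  values up to moving q within its sphere, so Re P >= 0 and P(0) = 1. Caratheodory's inequality on a
  slice containing P_n gives |P_n| <= 2. Comparing coefficients in B * P = C yields
  n |b_n| <= 2 (|b_0| + ... + |b_(n-1)|), hence |b_n| <= n + 1, that is |p_n| <= 1, and the geometric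
  series gives the inequality up to |q| = 1/2. It is sharp for f(q) = q (1 - q)^-1, all of whose
  coefficients are 1. The star inverse of B exists on the whole ball because the symmetrization
  B * B^c has real coefficients and no zeros, so that its reciprocal is an ordinary holomorphic
  function on the unit disc.
*)
theory Submission
  imports Defs "HOL-Complex_Analysis.Complex_Analysis"
begin

unbundle no vec_syntax
unbundle fps_syntax

section \<open>Slices and slice derivatives\<close>

text \<open>Takes a complex argument so that complex function theory can be carried to each
  slice.\<close>

definition slice_emb :: "quat \<Rightarrow> complex \<Rightarrow> quat" where
  "slice_emb I z = slice_point I (Re z) (Im z)"

lemma slice_emb_eq: "slice_emb I z = of_real (Re z) + of_real (Im z) * I"
  by (simp add: slice_emb_def slice_point_def)

lemma slice_point_eq_emb: "slice_point I x y = slice_emb I (Complex x y)"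
  by (simp add: slice_emb_def)

text \<open>Multiplicativity of the norm forces \<open>norm I = 1\<close>; adding this to the real
  part of \<open>I * I = - 1\<close> leaves \<open>2 * (qRe I)^2 = 0\<close>. Conversely, a purely
  imaginary quaternion squares to minus its squared norm.\<close>

lemma imag_units_iff: "I \<in> \<S> \<longleftrightarrow> qRe I = 0 \<and> norm I = 1"
proof
  assume "I \<in> \<S>"
  then have sq: "I * I = - 1" by (simp add: imag_units_def power2_eq_square)
  then have "norm I * norm I = 1" by (metis norm_minus_cancel norm_mult norm_one)
  then have n: "norm I = 1" by (metis abs_norm_cancel abs_1 real_sqrt_abs2 real_sqrt_one)
  then have "(qRe I)\<^sup>2 + (qI I)\<^sup>2 + (qJ I)\<^sup>2 + (qK I)\<^sup>2 = 1" by (simp add: norm_quat_def)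
  moreover have "qRe I * qRe I - qI I * qI I - qJ I * qJ I - qK I * qK I = - 1"
    using sq by (simp add: quat_eq_iff times_quat_def one_quat_def uminus_quat_def)
  ultimately have "2 * (qRe I)\<^sup>2 = 0" unfolding power2_eq_square by linarith
  then show "qRe I = 0 \<and> norm I = 1" using n by simp
next
  assume "qRe I = 0 \<and> norm I = 1"
  then have "qRe I = 0" "(qI I)\<^sup>2 + (qJ I)\<^sup>2 + (qK I)\<^sup>2 = 1"
    by (auto simp: norm_quat_def)
  then show "I \<in> \<S>"
    by (simp add: imag_units_def power2_eq_square quat_eq_iff times_quat_def one_quat_def
        uminus_quat_def algebra_simps)
qed

lemma imag_unit_square: "I \<in> \<S> \<Longrightarrow> I * I = - 1"
  by (simp add: imag_units_def power2_eq_square)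

lemma quat_of_real: "of_real x = Quat x 0 0 0"
  by (simp add: of_real_def one_quat_def scaleR_quat_def)

lemma slice_emb_simps [simp]:
  "slice_emb I 0 = 0" "slice_emb I 1 = 1" "slice_emb I \<i> = I"
  "slice_emb I (of_real x) = of_real x" "slice_emb I (of_nat n) = of_nat n"
  by (simp_all add: slice_emb_eq)

lemma slice_emb_add: "slice_emb I (z + w) = slice_emb I z + slice_emb I w"
  by (simp add: slice_emb_eq algebra_simps)

lemma slice_emb_diff: "slice_emb I (z - w) = slice_emb I z - slice_emb I w"
  by (simp add: slice_emb_eq algebra_simps)

lemma slice_emb_scaleR: "slice_emb I (r *\<^sub>R z) = r *\<^sub>R slice_emb I z"
  by (simp add: slice_emb_eq scaleR_conv_of_real algebra_simps)

text \<open>Since \<open>I * I = - 1\<close>, \<open>slice_emb I\<close> is a ring embedding of the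
  complex numbers; identities proved there can be transported to the slice.\<close>

lemma slice_emb_mult:
  assumes "I \<in> \<S>"
  shows "slice_emb I (z * w) = slice_emb I z * slice_emb I w"
proof -
  have "qRe I = 0" "(qI I)\<^sup>2 + (qJ I)\<^sup>2 + (qK I)\<^sup>2 = 1"
    using assms by (auto simp: imag_units_iff norm_quat_def)
  then show ?thesis
    unfolding slice_emb_eq
    by (simp add: quat_eq_iff times_quat_def plus_quat_def quat_of_real) algebra
qed

lemma slice_emb_power: "I \<in> \<S> \<Longrightarrow> slice_emb I (z ^ n) = slice_emb I z ^ n"
  by (induction n) (simp_all add: slice_emb_mult)

lemma slice_emb_inverse:
  assumes "I \<in> \<S>"
  shows "slice_emb I (inverse z) = inverse (slice_emb I z)"
proof (cases "z = 0")
  case False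
  then have "slice_emb I (inverse z) * slice_emb I z = 1"
    using assms by (simp flip: slice_emb_mult)
  then show ?thesis by (metis inverse_unique inverse_inverse_eq)
qed simp

lemma norm_slice_emb:
  assumes "I \<in> \<S>"
  shows "norm (slice_emb I z) = norm z"
proof -
  have "qRe I = 0" "(qI I)\<^sup>2 + (qJ I)\<^sup>2 + (qK I)\<^sup>2 = 1"
    using assms by (auto simp: imag_units_iff norm_quat_def)
  then have "(Re z)\<^sup>2 + (Im z * qI I)\<^sup>2 + (Im z * qJ I)\<^sup>2 + (Im z * qK I)\<^sup>2 = (Re z)\<^sup>2 + (Im z)\<^sup>2"
    by algebra
  then show ?thesis
    using \<open>qRe I = 0\<close>
    by (simp add: slice_emb_eq norm_quat_def cmod_def times_quat_def plus_quat_def quat_of_real)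
qed

lemma qRe_slice_emb: "I \<in> \<S> \<Longrightarrow> qRe (slice_emb I z) = Re z"
  by (simp add: imag_units_iff slice_emb_eq plus_quat_def times_quat_def quat_of_real)

lemma bounded_linear_slice_emb: "I \<in> \<S> \<Longrightarrow> bounded_linear (slice_emb I)"
  by (rule bounded_linear_intro[where K = 1])
    (simp_all add: slice_emb_add slice_emb_scaleR norm_slice_emb)

lemma slice_emb_in_ball_iff: "I \<in> \<S> \<Longrightarrow> slice_emb I z \<in> \<bool> \<longleftrightarrow> norm z < 1"
  by (simp add: unit_ball_def norm_slice_emb)

text \<open>The unit is the normalised vector part of \<open>q\<close>. A real \<open>q\<close> has
  none, but lies on every slice, so i is chosen.\<close>

lemma ex_slice_emb:
  obtains I z where "I \<in> \<S>" "q = slice_emb I z"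
proof -
  define v where "v = q - of_real (qRe q)"
  show thesis
  proof (cases "v = 0")
    case True
    have "Quat 0 1 0 0 \<in> \<S>" by (simp add: imag_units_iff norm_quat_def)
    moreover have "q = slice_emb (Quat 0 1 0 0) (of_real (qRe q))"
      using True by (simp add: v_def)
    ultimately show thesis using that by blast
  next
    case False
    define I where "I = v /\<^sub>R norm v"
    have "I \<in> \<S>"
      using False
      by (simp add: imag_units_iff I_def) (simp add: v_def minus_quat_def quat_of_real scaleR_quat_def)
    moreover have "q = slice_emb I (Complex (qRe q) (norm v))"
      using False by (simp add: slice_emb_eq I_def v_def flip: scaleR_conv_of_real)
    ultimately show thesis using that by blast
  qed
qed

lemma imag_units_nonempty: "\<S> \<noteq> {}"
  using ex_slice_emb by blast

section \<open>Slice derivative and regularity from a slicewise differential\<close>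

context
  fixes f D :: "quat \<Rightarrow> quat"
  assumes deriv: "\<And>I z. I \<in> \<S> \<Longrightarrow> norm z < 1 \<Longrightarrow>
    ((\<lambda>z. f (slice_emb I z)) has_derivative (\<lambda>h. slice_emb I h * D (slice_emb I z))) (at z)"
begin

text \<open>That the differential is left multiplication of \<open>D\<close> by the slice encodes
  the Cauchy-Riemann equation: the directions 1 and i give the partial derivatives \<open>D\<close>
  and \<open>I * D\<close>.\<close>

lemma slice_has_vector_derivative:
  assumes I: "I \<in> \<S>" and xy: "slice_point I x y \<in> \<bool>"
  shows "((\<lambda>t. f (slice_point I t y)) has_vector_derivative D (slice_point I x y)) (at x)"
    and "((\<lambda>t. f (slice_point I x t)) has_vector_derivative I * D (slice_point I x y)) (at y)"
proof -
  have z: "norm (Complex x y) < 1"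
    using xy by (simp add: slice_point_eq_emb slice_emb_in_ball_iff[OF I])
  have c1: "((\<lambda>t. Complex t y) has_derivative (\<lambda>h. of_real h)) (at x)"
    by (simp add: Complex_eq) (auto intro!: derivative_eq_intros)
  have c2: "((\<lambda>t. Complex x t) has_derivative (\<lambda>h. of_real h * \<i>)) (at y)"
    by (simp add: Complex_eq) (auto intro!: derivative_eq_intros)
  show "((\<lambda>t. f (slice_point I t y)) has_vector_derivative D (slice_point I x y)) (at x)"
    using has_derivative_compose[OF c1 deriv[OF I z]]
    by (simp add: has_vector_derivative_def slice_point_eq_emb scaleR_conv_of_real)
  show "((\<lambda>t. f (slice_point I x t)) has_vector_derivative I * D (slice_point I x y)) (at y)"
    using has_derivative_compose[OF c2 deriv[OF I z]]
    by (simp add: has_vector_derivative_def slice_point_eq_emb scaleR_conv_of_real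
        slice_emb_mult[OF I] mult.assoc)
qed

lemma partial_x_eq:
  "I \<in> \<S> \<Longrightarrow> slice_point I x y \<in> \<bool> \<Longrightarrow> partial_x f I x y = D (slice_point I x y)"
  and partial_y_eq:
  "I \<in> \<S> \<Longrightarrow> slice_point I x y \<in> \<bool> \<Longrightarrow> partial_y f I x y = I * D (slice_point I x y)"
  unfolding partial_x_def partial_y_def
  by (blast intro: vector_derivative_at slice_has_vector_derivative)+

text \<open>As \<open>I * (I * D) = - D\<close>, every unit and every parametrisation of
  \<open>q\<close> yields \<open>D q\<close>; uniqueness of the described value holds because
  \<open>q\<close> lies on at least one slice.\<close>

lemma slice_deriv_eq:
  assumes "q \<in> \<bool>"
  shows "slice_deriv f q = D q"
  unfolding slice_deriv_def
proof (rule the_equality)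
  have half: "(1/2) *\<^sub>R (partial_x f I x y - I * partial_y f I x y) = D q"
    if "I \<in> \<S>" "q = slice_point I x y" for I x y
    using assms that
    by (simp add: partial_x_eq partial_y_eq imag_unit_square flip: mult.assoc scaleR_2)
  then show "\<forall>I\<in>\<S>. \<forall>x y. q = slice_point I x y \<longrightarrow>
      D q = (1/2) *\<^sub>R (partial_x f I x y - I * partial_y f I x y)"
    by simp
  show "d = D q" if "\<forall>I\<in>\<S>. \<forall>x y. q = slice_point I x y \<longrightarrow>
      d = (1/2) *\<^sub>R (partial_x f I x y - I * partial_y f I x y)" for d
    using that half ex_slice_emb[of q] unfolding slice_emb_def by metis
qed

lemma slice_regularI:
  assumes cont: "continuous_on \<bool> D"
  shows "slice_regular f"
  unfolding slice_regular_def slice_C1_def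
proof (intro ballI conjI allI impI)
  fix I x y assume I: "I \<in> \<S>"
  show "(\<lambda>t. f (slice_point I t y)) differentiable (at x)"
    and "(\<lambda>t. f (slice_point I x t)) differentiable (at y)"
    and "(1/2) *\<^sub>R (partial_x f I x y + I * partial_y f I x y) = 0"
    if "slice_point I x y \<in> \<bool>"
    using slice_has_vector_derivative[OF I that] that
    by (auto intro: differentiableI_vector
        simp: partial_x_eq partial_y_eq imag_unit_square I simp flip: mult.assoc)
  have c: "continuous_on {(x, y). slice_point I x y \<in> \<bool>} (\<lambda>(x, y). D (slice_point I x y))"
  proof -
    have "continuous_on {(x, y). slice_point I x y \<in> \<bool>} (\<lambda>p. D (slice_point I (fst p) (snd p)))"
      by (rule continuous_on_compose2[OF cont])
        (auto simp: slice_point_def intro!: continuous_intros)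
    then show ?thesis by (simp add: case_prod_beta')
  qed
  then show "continuous_on {(x, y). slice_point I x y \<in> \<bool>} (\<lambda>(x, y). partial_x f I x y)"
    by (rule continuous_on_eq) (auto simp: partial_x_eq I)
  have "continuous_on {(x, y). slice_point I x y \<in> \<bool>} (\<lambda>(x, y). I * D (slice_point I x y))"
    using continuous_on_mult_left[OF c, of I] by (simp add: case_prod_beta')
  then show "continuous_on {(x, y). slice_point I x y \<in> \<bool>} (\<lambda>(x, y). partial_y f I x y)"
    by (rule continuous_on_eq) (auto simp: partial_y_eq I)
qed

end

section \<open>Slice power series and the star product\<close>

text \<open>Passing to the real series of coefficient norms keeps the radius and commutes with
  differentiation, which reduces the noncommutative case to the real one.\<close>

lemma fps_conv_radius_deriv_norm:
  fixes f :: "'a :: {banach, real_normed_div_algebra} fps"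
  shows "fps_conv_radius (fps_deriv f) \<ge> fps_conv_radius f"
proof -
  define g where "g = Abs_fps (\<lambda>n. norm (f $ n))"
  have nth: "norm (fps_deriv f $ n) = fps_deriv g $ n" for n
    by (simp add: g_def norm_mult del: of_nat_Suc)
  have "fps_conv_radius f = fps_conv_radius g"
    by (simp add: g_def)
  also have "\<dots> \<le> fps_conv_radius (fps_deriv g)"
    by (rule fps_conv_radius_deriv)
  also have "\<dots> = fps_conv_radius (fps_deriv f)"
    unfolding fps_conv_radius_def by (rule conv_radius_cong) (simp flip: nth del: fps_deriv_nth)
  finally show ?thesis .
qed

lemma norm_summable_fps_real:
  fixes f :: "'a :: {banach, real_normed_div_algebra} fps"
  assumes "1 \<le> fps_conv_radius f" "0 \<le> r" "r < 1"
  shows "summable (\<lambda>n. norm (f $ n) * r ^ n)"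
proof -
  have "ereal (norm (of_real r :: 'a)) < fps_conv_radius f"
    using assms by (simp add: less_le_trans[of "ereal r" 1] flip: one_ereal_def)
  from norm_summable_fps[OF this] show ?thesis
    using assms by (simp add: norm_mult norm_power)
qed

text \<open>
  \<open>star_act f q 1\<close> is the value at \<open>q\<close> of the slice regular function with coefficients \<open>f\<close>.
  The extra factor \<open>w\<close> turns the star product, which is not the pointwise one and whose
  coefficients are those of the product of formal power series, into composition of the maps
  \<open>star_act f q\<close>.
\<close>
definition star_act :: "quat fps \<Rightarrow> quat \<Rightarrow> quat \<Rightarrow> quat" where
  "star_act f q w = (\<Sum>n. q ^ n * w * f $ n)"

lemma star_act_norm_summable:
  assumes "1 \<le> fps_conv_radius f" "norm q < 1"
  shows "summable (\<lambda>n. norm (q ^ n * w * f $ n))"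
proof -
  have "summable (\<lambda>n. norm w * (norm (f $ n) * norm q ^ n))"
    by (intro summable_mult norm_summable_fps_real) (use assms in auto)
  then show ?thesis by (simp add: norm_mult norm_power mult_ac)
qed

lemma star_act_sums:
  assumes "1 \<le> fps_conv_radius f" "norm q < 1"
  shows "(\<lambda>n. q ^ n * w * f $ n) sums star_act f q w"
  unfolding star_act_def
  by (rule summable_sums, rule summable_norm_cancel, rule star_act_norm_summable[OF assms])

lemma star_act_0 [simp]: "star_act f 0 w = w * f $ 0"
  unfolding star_act_def by (subst suminf_finite[of "{0}"]) auto

lemma star_act_1 [simp]: "star_act 1 q w = w"
  unfolding star_act_def by (subst suminf_finite[of "{0}"]) auto

lemma conj_power: "(w::'a::division_ring) \<noteq> 0 \<Longrightarrow> (inverse w * q * w) ^ n = inverse w * q ^ n * w"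
proof (induction n)
  case (Suc n)
  assume w: "w \<noteq> 0"
  have "w * (inverse w * x) = x" for x
    using w by (simp flip: mult.assoc)
  with Suc w show ?case by (simp add: mult.assoc)
qed simp

text \<open>Moving \<open>w\<close> to the left turns \<open>q ^ n * w\<close> into
  \<open>w * (inverse w * q * w) ^ n\<close>. This is how a star product is evaluated pointwise, at
  the cost of moving \<open>q\<close> within its sphere.\<close>

lemma star_act_conj:
  assumes "1 \<le> fps_conv_radius f" "norm q < 1" "w \<noteq> 0"
  shows "star_act f q w = w * star_act f (inverse w * q * w) 1"
proof (rule sums_unique2)
  show "(\<lambda>n. q ^ n * w * f $ n) sums star_act f q w"
    using assms by (intro star_act_sums)
  have "norm (inverse w * q * w) = norm (w * inverse w * q)"
    by (simp only: norm_mult mult_ac)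
  then have "norm (inverse w * q * w) < 1"
    using assms by simp
  from sums_mult[OF star_act_sums[OF assms(1) this, of 1], of w]
  show "(\<lambda>n. q ^ n * w * f $ n) sums (w * star_act f (inverse w * q * w) 1)"
    using assms(3) by (simp add: conj_power flip: mult.assoc)
qed

text \<open>Both sides sum the same absolutely convergent double family, once by rows and once along
  the diagonals \<open>m + k = n\<close>. Coefficients multiply on the right, so the factor
  \<open>s\<close> acts first.\<close>

lemma star_act_star_act:
  assumes s: "1 \<le> fps_conv_radius s" and t: "1 \<le> fps_conv_radius t" and q: "norm q < 1"
  shows "star_act t q (star_act s q w) = star_act (s * t) q w"
proof -
  define u where "u = (\<lambda>(m, k). q ^ (m + k) * w * s $ k * t $ m)"
  have u_eq: "u (m, k) = q ^ m * (q ^ k * w * s $ k) * t $ m" for m k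
    by (simp add: u_def power_add mult.assoc)
  have inner: "((\<lambda>k. u (m, k)) has_sum (q ^ m * star_act s q w * t $ m)) UNIV" for m
    unfolding u_eq
    by (intro has_sum_cmult_left has_sum_cmult_right norm_summable_imp_has_sum
        star_act_norm_summable star_act_sums s q)
  have "Infinite_Sum.abs_summable_on u (UNIV \<times> UNIV)"
  proof (subst Infinite_Sum.abs_summable_on_Sigma_iff, safe)
    \<comment> \<open>Multiplicativity of the norm splits the double family of norms into a product
      of two summable single families.\<close>
    have norm_u: "norm (u (m, k)) = norm (q ^ m * 1 * t $ m) * norm (q ^ k * w * s $ k)" for m k
      by (simp add: u_eq norm_mult)
    have sk: "(\<lambda>k. norm (q ^ k * w * s $ k)) summable_on UNIV"
      by (intro norm_summable_imp_summable_on) (simp add: star_act_norm_summable s q)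
    have tm: "(\<lambda>m. norm (q ^ m * 1 * t $ m)) summable_on UNIV"
      by (intro norm_summable_imp_summable_on) (use star_act_norm_summable[OF t q, of 1] in simp)
    show "(\<lambda>k. norm (u (m, k))) summable_on UNIV" for m
      unfolding norm_u by (intro summable_on_cmult_right sk)
    have "(\<lambda>m. norm (infsum (\<lambda>k. norm (u (m, k))) UNIV)) =
        (\<lambda>m. norm (q ^ m * 1 * t $ m) * infsum (\<lambda>k. norm (q ^ k * w * s $ k)) UNIV)"
      unfolding norm_u by (simp add: infsum_cmult_right' abs_mult infsum_nonneg)
    then show "(\<lambda>m. norm (infsum (\<lambda>k. norm (u (m, k))) UNIV)) summable_on UNIV"
      using summable_on_cmult_left[OF tm] by simp
  qed
  then obtain S where S: "(u has_sum S) (UNIV \<times> UNIV)"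
    using Infinite_Sum.abs_summable_summable unfolding summable_on_def by blast
  have "((\<lambda>m. q ^ m * star_act s q w * t $ m) has_sum S) UNIV"
    by (rule has_sum_SigmaD[OF S]) (rule inner)
  then have 1: "star_act t q (star_act s q w) = S"
    unfolding star_act_def[of t] by (blast dest: has_sum_imp_sums sums_unique)
  \<comment> \<open>Reindexing by \<open>n = m + k\<close>; the natural-number subtraction is exact
    because \<open>k\<close> stays in \<open>{..n}\<close>.\<close>
  have "((\<lambda>(n, k). u (n - k, k)) has_sum S) (SIGMA n:UNIV. {..n}) \<longleftrightarrow> (u has_sum S) (UNIV \<times> UNIV)"
    by (rule has_sum_reindex_bij_witness[where i = "\<lambda>(m, k). (m + k, k)"
          and j = "\<lambda>(n, k). (n - k, k)"]) auto
  with S have "((\<lambda>(n, k). u (n - k, k)) has_sum S) (SIGMA n:UNIV. {..n})"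
    by simp
  then have "((\<lambda>n. q ^ n * w * (s * t) $ n) has_sum S) UNIV"
  proof (rule has_sum_SigmaD)
    fix n
    have "q ^ n * w * (s * t) $ n = (\<Sum>k\<le>n. u (n - k, k))"
      by (simp add: u_def fps_mult_nth sum_distrib_left atLeast0AtMost mult.assoc)
    then show "((\<lambda>k. case (n, k) of (n, k) \<Rightarrow> u (n - k, k)) has_sum (q ^ n * w * (s * t) $ n)) {..n}"
      by (simp add: has_sum_finite)
  qed
  then have "star_act (s * t) q w = S"
    unfolding star_act_def by (blast dest: has_sum_imp_sums sums_unique)
  with 1 show ?thesis by simp
qed

text \<open>Termwise differentiation on a disc of radius \<open>r\<close> with
  \<open>norm z < r < 1\<close>, where the differentiated series converges uniformly by the
  Weierstrass test.\<close>

lemma star_act_slice_has_derivative: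
  assumes f: "1 \<le> fps_conv_radius f" and I: "I \<in> \<S>" and z: "norm z < 1"
  shows "((\<lambda>z. star_act f (slice_emb I z) 1) has_derivative
    (\<lambda>h. slice_emb I h * star_act (fps_deriv f) (slice_emb I z) 1)) (at z)"
proof -
  interpret E: bounded_linear "slice_emb I" by (rule bounded_linear_slice_emb[OF I])
  obtain r where r: "norm z < r" "r < 1" using z dense by blast
  then have r0: "0 \<le> r" using norm_ge_zero[of z] by linarith
  have f': "1 \<le> fps_conv_radius (fps_deriv f)"
    using f fps_conv_radius_deriv_norm order_trans by blast
  \<comment> \<open>The derivative of the \<open>i\<close>-th term with the increment
    \<open>slice_emb I h\<close> split off on the left. For \<open>i = 0\<close> the truncated
    exponent is harmless, since the factor \<open>of_nat i\<close> vanishes.\<close>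
  define T' where "T' i x = slice_emb I (of_nat i * x ^ (i - 1)) * f $ i" for i x
  have sums_T': "(\<lambda>i. T' i x) sums star_act (fps_deriv f) (slice_emb I x) 1" if "norm x < 1" for x
  proof -
    have eq: "T' (Suc i) x = slice_emb I x ^ i * 1 * fps_deriv f $ i" for i
      using mult_of_nat_commute[of "Suc i" "slice_emb I x ^ i"]
      by (simp add: T'_def slice_emb_mult[OF I] slice_emb_power[OF I] del: of_nat_Suc
          flip: mult.assoc)
    have "(\<lambda>i. T' (Suc i) x) sums star_act (fps_deriv f) (slice_emb I x) 1"
      unfolding eq using f' that by (intro star_act_sums) (simp_all add: norm_slice_emb I)
    then show ?thesis using sums_Suc_iff[of "\<lambda>i. T' i x"] by (simp add: T'_def[of 0])
  qed
  have norm_T': "norm (T' (Suc i) x) \<le> norm (fps_deriv f $ i) * r ^ i" if "norm x \<le> r" for i x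
  proof -
    have "norm x ^ i \<le> r ^ i" using that by (intro power_mono) auto
    then show ?thesis
      by (simp add: T'_def norm_mult norm_slice_emb I norm_power mult_right_mono mult_left_mono
          norm_of_nat mult_ac del: of_nat_Suc)
  qed
  have "summable (\<lambda>i. norm (fps_deriv f $ i) * r ^ i)"
    by (rule norm_summable_fps_real) (use f' r r0 in auto)
  \<comment> \<open>The majorant is shifted by one: the differentiated constant term contributes
    0.\<close>
  then have sumM: "summable (\<lambda>i. case i of 0 \<Rightarrow> 0 | Suc i \<Rightarrow> norm (fps_deriv f $ i) * r ^ i)"
    by (subst summable_Suc_iff[symmetric]) simp
  have "uniform_limit (ball 0 r) (\<lambda>n x. \<Sum>i<n. T' i x) (\<lambda>x. \<Sum>i. T' i x) sequentially"
    by (rule Weierstrass_m_test[OF _ sumM])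
      (auto split: nat.split simp: norm_T' less_imp_le simp del: fps_deriv_nth, simp add: T'_def)
  also have "?this \<longleftrightarrow> uniform_limit (ball 0 r) (\<lambda>n x. \<Sum>i<n. T' i x)
      (\<lambda>x. star_act (fps_deriv f) (slice_emb I x) 1) sequentially"
    by (intro uniform_limit_cong') (use sums_T' r in \<open>auto simp: sums_iff\<close>)
  finally have unif: "uniform_limit (ball 0 r) (\<lambda>n x. \<Sum>i<n. T' i x)
      (\<lambda>x. star_act (fps_deriv f) (slice_emb I x) 1) sequentially" .
  have "\<exists>g. \<forall>x\<in>ball 0 r. (\<lambda>n. slice_emb I (x ^ n) * f $ n) sums g x \<and>
      (g has_derivative (\<lambda>h. slice_emb I h * star_act (fps_deriv f) (slice_emb I x) 1))
        (at x within ball 0 r)"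
  proof (rule has_derivative_series)
    show "convex (ball 0 r :: complex set)" by simp
    show "((\<lambda>x. slice_emb I (x ^ n) * f $ n) has_derivative (\<lambda>h. slice_emb I h * T' n x))
        (at x within ball 0 r)" for n x
    proof -
      have "((\<lambda>x. x ^ n) has_derivative (\<lambda>h. h * (of_nat n * x ^ (n - 1)))) (at x within ball 0 r)"
        by (rule derivative_eq_intros refl)+ (simp add: mult_ac)
      from has_derivative_mult_left[OF E.has_derivative[OF this], of "f $ n"]
      show ?thesis by (simp add: T'_def slice_emb_mult[OF I] mult.assoc)
    qed
    show "\<forall>\<^sub>F n in sequentially. \<forall>x\<in>ball 0 r. \<forall>h.
        norm ((\<Sum>i<n. slice_emb I h * T' i x) -
          slice_emb I h * star_act (fps_deriv f) (slice_emb I x) 1) \<le> e * norm h"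
      if "e > 0" for e
      using uniform_limitD[OF unif that]
    proof eventually_elim
      case (elim n)
      show ?case
      proof (intro ballI allI)
        fix x :: complex and h assume "x \<in> ball 0 r"
        then have "norm ((\<Sum>i<n. T' i x) - star_act (fps_deriv f) (slice_emb I x) 1) \<le> e"
          using elim by (auto simp: dist_norm less_imp_le)
        then have "norm (slice_emb I h * ((\<Sum>i<n. T' i x) -
            star_act (fps_deriv f) (slice_emb I x) 1)) \<le> e * norm h"
          by (simp add: norm_mult norm_slice_emb I mult.commute[of "norm h"] mult_right_mono)
        then show "norm ((\<Sum>i<n. slice_emb I h * T' i x) -
            slice_emb I h * star_act (fps_deriv f) (slice_emb I x) 1) \<le> e * norm h"
          by (simp add: right_diff_distrib sum_distrib_left)
      qed
    qed
    show "z \<in> ball 0 r" using r by simp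
    show "(\<lambda>n. slice_emb I (z ^ n) * f $ n) sums star_act f (slice_emb I z) 1"
      using star_act_sums[OF f, of "slice_emb I z" 1] z by (simp add: norm_slice_emb I slice_emb_power)
  qed
  then obtain g where g: "\<And>x. x \<in> ball 0 r \<Longrightarrow> (\<lambda>n. slice_emb I (x ^ n) * f $ n) sums g x"
    "\<And>x. x \<in> ball 0 r \<Longrightarrow>
      (g has_derivative (\<lambda>h. slice_emb I h * star_act (fps_deriv f) (slice_emb I x) 1))
        (at x within ball 0 r)" by blast
  have g_eq: "g x = star_act f (slice_emb I x) 1" if "x \<in> ball 0 r" for x
    using g(1)[OF that] star_act_sums[OF f, of "slice_emb I x" 1] that r
    by (simp add: norm_slice_emb I slice_emb_power sums_iff)
  have zr: "z \<in> ball 0 r" using r by simp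
  show ?thesis
    by (rule has_derivative_transform_within_open[OF _ open_ball zr g_eq])
      (use g(2)[OF zr] at_within_open[OF zr open_ball] in simp)
qed

text \<open>The two coefficient algebras may differ, which lets radii pass between quaternionic and
  complex series.\<close>

lemma fps_conv_radius_le_norm:
  fixes f :: "'a :: {banach, real_normed_div_algebra} fps"
    and g :: "'b :: {banach, real_normed_div_algebra} fps"
  assumes "\<And>n. norm (g $ n) \<le> norm (f $ n)"
  shows "fps_conv_radius f \<le> fps_conv_radius g"
  unfolding fps_conv_radius_def[of g]
proof (rule conv_radius_geI_ex')
  fix r :: real assume r: "0 < r" "ereal r < fps_conv_radius f"
  then have "summable (\<lambda>n. norm (f $ n * of_real r ^ n))"
    by (intro norm_summable_fps) auto
  then have "summable (\<lambda>n. norm (f $ n) * r ^ n)"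
    using r by (simp add: norm_mult norm_power)
  then show "summable (\<lambda>n. g $ n * of_real r ^ n)"
    by (rule summable_comparison_test'[where N = 0])
      (use r in \<open>simp add: norm_mult norm_power mult_right_mono assms\<close>)
qed

section \<open>Inverses for the star product\<close>

text \<open>The target is polymorphic: one real series is read both as a complex series, where
  function theory applies, and as a quaternionic series, where it is central.\<close>

definition fps_of_real :: "real fps \<Rightarrow> 'a::real_algebra_1 fps" where
  "fps_of_real r = Abs_fps (\<lambda>n. of_real (r $ n))"

lemma fps_of_real_nth [simp]: "fps_of_real r $ n = of_real (r $ n)"
  by (simp add: fps_of_real_def)

lemma fps_of_real_mult: "fps_of_real (r * s) = fps_of_real r * fps_of_real s"
  by (simp add: fps_eq_iff fps_mult_nth)

lemma fps_of_real_add: "fps_of_real (r + s) = fps_of_real r + fps_of_real s"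
  by (simp add: fps_eq_iff)

lemma fps_of_real_1 [simp]: "fps_of_real 1 = 1"
  by (simp add: fps_eq_iff)

section \<open>Component series, conjugation and symmetrization\<close>

definition "fps_qRe f = Abs_fps (\<lambda>n. qRe (f $ n))"
definition "fps_qI f = Abs_fps (\<lambda>n. qI (f $ n))"
definition "fps_qJ f = Abs_fps (\<lambda>n. qJ (f $ n))"
definition "fps_qK f = Abs_fps (\<lambda>n. qK (f $ n))"

lemmas fps_quat_component_defs = fps_qRe_def fps_qI_def fps_qJ_def fps_qK_def

lemma fps_quat_eq_iff:
  "f = g \<longleftrightarrow> fps_qRe f = fps_qRe g \<and> fps_qI f = fps_qI g \<and> fps_qJ f = fps_qJ g \<and> fps_qK f = fps_qK g"
  by (auto simp: fps_quat_component_defs fps_eq_iff quat_eq_iff)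

lemma quat_sel_sum:
  "qRe (sum f A) = (\<Sum>x\<in>A. qRe (f x))" "qI (sum f A) = (\<Sum>x\<in>A. qI (f x))"
  "qJ (sum f A) = (\<Sum>x\<in>A. qJ (f x))" "qK (sum f A) = (\<Sum>x\<in>A. qK (f x))"
  by (induction A rule: infinite_finite_induct) (simp_all add: zero_quat_def plus_quat_def)

text \<open>Reduces identities between noncommutative series to identities in the commutative ring
  of real series.\<close>

lemma fps_quat_mult:
  "fps_qRe (f * g) = fps_qRe f * fps_qRe g - fps_qI f * fps_qI g - fps_qJ f * fps_qJ g - fps_qK f * fps_qK g"
  "fps_qI (f * g) = fps_qRe f * fps_qI g + fps_qI f * fps_qRe g + fps_qJ f * fps_qK g - fps_qK f * fps_qJ g"
  "fps_qJ (f * g) = fps_qRe f * fps_qJ g - fps_qI f * fps_qK g + fps_qJ f * fps_qRe g + fps_qK f * fps_qI g"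
  "fps_qK (f * g) = fps_qRe f * fps_qK g + fps_qI f * fps_qJ g - fps_qJ f * fps_qI g + fps_qK f * fps_qRe g"
  by (simp_all add: fps_quat_component_defs fps_eq_iff fps_mult_nth quat_sel_sum times_quat_def
      sum.distrib sum_subtractf)

lemma fps_quat_of_real [simp]:
  "fps_qRe (fps_of_real r) = r" "fps_qI (fps_of_real r) = 0"
  "fps_qJ (fps_of_real r) = 0" "fps_qK (fps_of_real r) = 0"
  by (simp_all add: fps_quat_component_defs fps_eq_iff quat_of_real)

lemma fps_of_real_commute: "fps_of_real r * f = f * (fps_of_real r :: quat fps)"
  by (simp add: fps_quat_eq_iff fps_quat_mult mult.commute)

definition fps_qcnj :: "quat fps \<Rightarrow> quat fps" where
  "fps_qcnj f = Abs_fps (\<lambda>n. Quat (qRe (f $ n)) (- qI (f $ n)) (- qJ (f $ n)) (- qK (f $ n)))"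

lemma fps_qcnj_components [simp]:
  "fps_qRe (fps_qcnj f) = fps_qRe f" "fps_qI (fps_qcnj f) = - fps_qI f"
  "fps_qJ (fps_qcnj f) = - fps_qJ f" "fps_qK (fps_qcnj f) = - fps_qK f"
  by (simp_all add: fps_quat_component_defs fps_eq_iff fps_qcnj_def)

definition fps_symm :: "quat fps \<Rightarrow> real fps" where
  "fps_symm f = fps_qRe f * fps_qRe f + fps_qI f * fps_qI f + fps_qJ f * fps_qJ f + fps_qK f * fps_qK f"

lemma fps_qcnj_mult:
  "fps_qcnj f * f = fps_of_real (fps_symm f)" "f * fps_qcnj f = fps_of_real (fps_symm f)"
  by (simp_all add: fps_quat_eq_iff fps_quat_mult fps_symm_def mult.commute)

lemma sums_Quat:
  assumes "a sums A" "b sums B" "c sums C" "d sums D"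
  shows "(\<lambda>n. Quat (a n) (b n) (c n) (d n)) sums Quat A B C D"
proof -
  have eq: "Quat a b c d = a *\<^sub>R Quat 1 0 0 0 + b *\<^sub>R Quat 0 1 0 0 + c *\<^sub>R Quat 0 0 1 0 + d *\<^sub>R Quat 0 0 0 1"
    for a b c d by (simp add: plus_quat_def scaleR_quat_def)
  show ?thesis
    unfolding eq[of "a _"] eq[of A] by (intro sums_add sums_scaleR_left assms)
qed

text \<open>The candidate is \<open>J = - (\<alpha> * inverse \<beta>)\<close>: equal norms give it
  norm 1, and orthogonality makes its real part vanish. If \<open>\<beta> = 0\<close>, then
  \<open>\<alpha> = 0\<close> and any unit serves.\<close>

lemma ex_imag_unit_root:
  fixes \<alpha> \<beta> :: quat
  assumes "norm \<alpha> = norm \<beta>" "inner \<alpha> \<beta> = 0"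
  obtains J where "J \<in> \<S>" "\<alpha> + J * \<beta> = 0"
proof (cases "\<beta> = 0")
  case True
  then show thesis using assms imag_units_nonempty that by fastforce
next
  case False
  define J where "J = - (\<alpha> * inverse \<beta>)"
  have "qRe (\<alpha> * inverse \<beta>) = inner \<alpha> \<beta> / ((qRe \<beta>)\<^sup>2 + (qI \<beta>)\<^sup>2 + (qJ \<beta>)\<^sup>2 + (qK \<beta>)\<^sup>2)"
    by (simp add: times_quat_def inverse_quat_def scaleR_quat_def inner_quat_def add_divide_distrib)
  then have "qRe J = 0"
    using assms(2) by (simp add: J_def uminus_quat_def)
  moreover have "norm J = 1"
    using False assms(1) by (simp add: J_def norm_mult norm_inverse)
  ultimately have "J \<in> \<S>" by (simp add: imag_units_iff)
  moreover have "\<alpha> + J * \<beta> = 0"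
    using False by (simp add: J_def mult.assoc)
  ultimately show thesis using that by blast
qed

lemma fps_conv_radius_of_real_components:
  assumes b: "1 \<le> fps_conv_radius b" and c: "c \<in> {fps_qRe b, fps_qI b, fps_qJ b, fps_qK b}"
  shows "1 \<le> fps_conv_radius (fps_of_real c :: complex fps)"
proof -
  have "\<bar>qRe q\<bar> \<le> norm q" "\<bar>qI q\<bar> \<le> norm q" "\<bar>qJ q\<bar> \<le> norm q" "\<bar>qK q\<bar> \<le> norm q" for q
    unfolding norm_quat_def by (rule real_le_rsqrt; simp)+
  then show ?thesis
    using c
    by (intro order_trans[OF b fps_conv_radius_le_norm]) (auto simp: fps_quat_component_defs)
qed

lemma fps_conv_radius_of_real_symm:
  assumes b: "1 \<le> fps_conv_radius b"
  shows "1 \<le> fps_conv_radius (fps_of_real (fps_symm b) :: complex fps)"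
  unfolding fps_symm_def fps_of_real_add fps_of_real_mult
  by (intro order_trans[OF _ fps_conv_radius_add] order_trans[OF _ fps_conv_radius_mult]
      min.boundedI fps_conv_radius_of_real_components[OF b]) auto

text \<open>
  On the sphere \<open>x + y \<S>\<close> the series \<open>b\<close> is the affine function \<open>\<alpha> + J \<beta>\<close> of \<open>J\<close>, and
  the symmetrization at \<open>x + \<i> y\<close> is \<open>|\<alpha>|\<^sup>2 - |\<beta>|\<^sup>2 + 2 \<i> \<alpha> \<bullet> \<beta>\<close>; if it vanishes, then \<open>b\<close>
  has a zero on this sphere.
\<close>
lemma eval_fps_symm_nonzero:
  assumes b: "1 \<le> fps_conv_radius b" and nz: "\<And>q. norm q < 1 \<Longrightarrow> star_act b q 1 \<noteq> 0"
    and z: "norm z < 1"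
  shows "eval_fps (fps_of_real (fps_symm b)) (z :: complex) \<noteq> 0"
proof -
  let ?cs = "{fps_qRe b, fps_qI b, fps_qJ b, fps_qK b}"
  note rad = fps_conv_radius_of_real_components[OF b]
  have rad2: "1 \<le> fps_conv_radius (fps_of_real (c * c) :: complex fps)" if "c \<in> ?cs" for c
    unfolding fps_of_real_mult using rad[OF that] by (intro order_trans[OF _ fps_conv_radius_mult]) simp
  have z_rad: "ereal (norm z) < fps_conv_radius f" if "1 \<le> fps_conv_radius f" for f :: "complex fps"
    using less_le_trans[of "ereal (norm z)" 1, OF _ that] z by (simp flip: one_ereal_def)
  define F where "F c = eval_fps (fps_of_real c) z" for c
  have F: "(\<lambda>n. (c $ n) *\<^sub>R z ^ n) sums F c" if "c \<in> ?cs" for c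
    using sums_eval_fps[OF z_rad[OF rad[OF that]]] by (simp add: F_def scaleR_conv_of_real)
  have comp: "(\<lambda>n. L (z ^ n) * c $ n) sums L (F c)"
    if "bounded_linear L" "c \<in> ?cs" for L :: "complex \<Rightarrow> real" and c
    using bounded_linear.sums[OF that(1) F[OF that(2)]]
    by (simp add: linear_simps(5)[OF that(1)] mult.commute)
  \<comment> \<open>The values of the four component series at \<open>z\<close> form a quaternion
    with complex coordinates; \<open>\<alpha>\<close> and \<open>\<beta>\<close> are its real and
    imaginary parts.\<close>
  define \<alpha> where "\<alpha> = Quat (Re (F (fps_qRe b))) (Re (F (fps_qI b))) (Re (F (fps_qJ b))) (Re (F (fps_qK b)))"
  define \<beta> where "\<beta> = Quat (Im (F (fps_qRe b))) (Im (F (fps_qI b))) (Im (F (fps_qJ b))) (Im (F (fps_qK b)))"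
  have "(\<lambda>n. Re (z ^ n) *\<^sub>R (b $ n)) sums \<alpha>"
    unfolding \<alpha>_def scaleR_quat_def
    using comp[OF bounded_linear_Re, of "fps_qRe b"] comp[OF bounded_linear_Re, of "fps_qI b"]
      comp[OF bounded_linear_Re, of "fps_qJ b"] comp[OF bounded_linear_Re, of "fps_qK b"]
    by (intro sums_Quat) (simp_all add: fps_quat_component_defs)
  moreover have "(\<lambda>n. Im (z ^ n) *\<^sub>R (b $ n)) sums \<beta>"
    unfolding \<beta>_def scaleR_quat_def
    using comp[OF bounded_linear_Im, of "fps_qRe b"] comp[OF bounded_linear_Im, of "fps_qI b"]
      comp[OF bounded_linear_Im, of "fps_qJ b"] comp[OF bounded_linear_Im, of "fps_qK b"]
    by (intro sums_Quat) (simp_all add: fps_quat_component_defs)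
  ultimately have ab: "(\<lambda>n. Re (z ^ n) *\<^sub>R (b $ n) + J * (Im (z ^ n) *\<^sub>R (b $ n))) sums (\<alpha> + J * \<beta>)" for J
    by (intro sums_add sums_mult)
  have "star_act b (slice_emb J z) 1 = \<alpha> + J * \<beta>" if J: "J \<in> \<S>" for J
  proof -
    have "slice_emb J z ^ n * 1 * b $ n = Re (z ^ n) *\<^sub>R (b $ n) + J * (Im (z ^ n) *\<^sub>R (b $ n))" for n
      unfolding slice_emb_power[OF J, symmetric] unfolding slice_emb_eq
      by (simp add: distrib_right mult.assoc flip: scaleR_conv_of_real)
    then show ?thesis unfolding star_act_def using ab[of J] by (simp add: sums_iff)
  qed
  then have nz': "\<alpha> + J * \<beta> \<noteq> 0" if "J \<in> \<S>" for J
    using nz[of "slice_emb J z"] that z by (simp add: norm_slice_emb)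
  have mult: "eval_fps (fps_of_real (c * c)) z = F c * F c" if "c \<in> ?cs" for c
    unfolding fps_of_real_mult F_def by (intro eval_fps_mult z_rad rad[OF that])
  have eval: "eval_fps (fps_of_real (fps_symm b)) z = F (fps_qRe b) * F (fps_qRe b) + F (fps_qI b) * F (fps_qI b)
      + F (fps_qJ b) * F (fps_qJ b) + F (fps_qK b) * F (fps_qK b)"
  proof -
    have add: "1 \<le> fps_conv_radius f \<Longrightarrow> 1 \<le> fps_conv_radius g \<Longrightarrow>
        1 \<le> fps_conv_radius (f + g) \<and> eval_fps (f + g) z = eval_fps f z + eval_fps g z"
      for f g :: "complex fps"
      using order_trans[OF _ fps_conv_radius_add[of f g]] eval_fps_add[of z f g] z_rad by simp
    show ?thesis
      unfolding fps_symm_def fps_of_real_add by (simp add: add rad2 mult)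
  qed
  show "eval_fps (fps_of_real (fps_symm b)) z \<noteq> 0"
  proof
    assume 0: "eval_fps (fps_of_real (fps_symm b)) z = 0"
    have "norm \<alpha> = norm \<beta>"
      using arg_cong[OF 0, of Re] unfolding eval
      by (simp add: norm_quat_def \<alpha>_def \<beta>_def power2_eq_square)
    moreover have "inner \<alpha> \<beta> = 0"
      using arg_cong[OF 0, of Im] unfolding eval
      by (simp add: inner_quat_def \<alpha>_def \<beta>_def algebra_simps)
    ultimately show False
      using ex_imag_unit_root nz' by blast
  qed
qed

text \<open>The inverse is the conjugate of \<open>b\<close> times the reciprocal of the
  symmetrization. The latter is real, hence central, so the inverse is two-sided; it converges on
  the unit ball because the symmetrization has no zeros in the unit disc.\<close>

lemma ex_star_inverse:
  assumes b: "1 \<le> fps_conv_radius b" and nz: "\<And>q. norm q < 1 \<Longrightarrow> star_act b q 1 \<noteq> 0"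
  obtains N where "1 \<le> fps_conv_radius N" "N * b = 1" "b * N = 1"
proof -
  define s where "s = fps_symm b"
  define C where "C = (fps_of_real s :: complex fps)"
  define E where "E = (fps_of_real (inverse s) :: quat fps)"
  have C: "1 \<le> fps_conv_radius C"
    unfolding C_def s_def by (rule fps_conv_radius_of_real_symm[OF b])
  note C_nz = eval_fps_symm_nonzero[OF b nz, folded s_def, folded C_def]
  have "eval_fps C 0 \<noteq> 0" using C_nz[of 0] by simp
  then have "s $ 0 \<noteq> 0" by (simp add: eval_fps_at_0 C_def)
  then have inv: "inverse s * s = 1" by (rule inverse_mult_eq_1)
  have "inverse C = fps_of_real (inverse s)"
  proof -
    have "C * fps_of_real (inverse s) = 1"
      using inv by (simp add: C_def mult.commute flip: fps_of_real_mult)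
    then show ?thesis by (rule fps_inverse_unique)
  qed
  moreover have "1 \<le> fps_conv_radius (inverse C)"
    by (rule order_trans[OF _ fps_conv_radius_inverse[of 1 C]]) (use C C_nz in auto)
  \<comment> \<open>\<open>E\<close> and \<open>inverse C\<close> have the same real coefficients in
    different algebras, so the radius found by complex analysis carries over.\<close>
  ultimately have "1 \<le> fps_conv_radius E"
    using fps_conv_radius_le_norm[of E "inverse C"] by (simp add: E_def)
  moreover have "1 \<le> fps_conv_radius (fps_qcnj b)"
    by (rule order_trans[OF b fps_conv_radius_le_norm]) (simp add: fps_qcnj_def norm_quat_def)
  ultimately have "1 \<le> fps_conv_radius (fps_qcnj b * E)"
    by (intro order_trans[OF _ fps_conv_radius_mult]) simp
  moreover have "fps_qcnj b * E * b = 1"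
  proof -
    have "fps_qcnj b * E * b = E * (fps_qcnj b * b)"
      by (simp add: E_def fps_of_real_commute mult.assoc)
    then show ?thesis by (simp add: fps_qcnj_mult E_def inv flip: s_def fps_of_real_mult)
  qed
  moreover have "b * (fps_qcnj b * E) = 1"
    using inv by (simp add: fps_qcnj_mult E_def mult.commute[of s] flip: mult.assoc s_def fps_of_real_mult)
  ultimately show thesis using that by blast
qed

section \<open>Caratheodory's coefficient inequality\<close>

text \<open>Averaging \<open>h\<close> over a circle of radius \<open>r < 1\<close> against a
  nonnegative trigonometric kernel gives \<open>1 - norm (h $ n) * r ^ n / 2\<close>, which is
  nonnegative because \<open>Re h\<close> is; then \<open>r\<close> tends to 1.\<close>

lemma caratheodory_coeff_bound:
  fixes h :: "complex fps"
  assumes h: "1 \<le> fps_conv_radius h" and h0: "h $ 0 = 1"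
    and Re: "\<And>z. norm z < 1 \<Longrightarrow> 0 \<le> Re (eval_fps h z)" and n: "0 < n"
  shows "norm (h $ n) \<le> 2"
proof -
  have bound: "norm (h $ n) * r ^ n \<le> 2" if r: "0 < r" "r < 1" for r
  proof -
    have rad: "ereal r < fps_conv_radius h"
      using less_le_trans[of "ereal r" 1, OF _ h] r by (simp flip: one_ereal_def)
    have sub: "cball 0 r \<subseteq> eball 0 (fps_conv_radius h)"
      using le_less_trans[OF _ rad] by auto
    have hol: "eval_fps h holomorphic_on cball 0 r"
      by (rule holomorphic_on_eval_fps[OF sub])
    then have hol': "eval_fps h holomorphic_on ball 0 r"
      by (rule holomorphic_on_subset) auto
    have rad0: "0 < fps_conv_radius h"
      using rad r by (meson ereal_less(2) less_trans)
    define e where "e = - cnj (sgn (h $ n))"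
    \<comment> \<open>Only an inequality: if \<open>h $ n = 0\<close>, then \<open>sgn\<close> and
      hence \<open>e\<close> are 0.\<close>
    have "norm e \<le> 1" by (simp add: e_def norm_sgn)
    have he: "e * h $ n = - of_real (norm (h $ n))"
    proof -
      have "cnj (sgn w) * w = of_real (norm w)" for w :: complex
        by (cases "w = 0") (simp_all add: sgn_eq complex_norm_square[symmetric] power2_eq_square
            mult.commute[of "cnj w"])
      then show ?thesis by (simp add: e_def)
    qed
    \<comment> \<open>On \<open>|u| = r\<close> the kernel is \<open>1 + Re (e (r/u)^n) \<ge> 0\<close>; \<open>e\<close> makes \<open>e * h $ n\<close> negative.\<close>
    define K where "K u = 1 + (e * (of_real r / u) ^ n + cnj e * (u / of_real r) ^ n) / 2" for u
    have K: "0 \<le> Re (K u)" "Im (K u) = 0" if "norm u = r" for u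
    proof -
      have "u * cnj u = of_real r * of_real r"
        using that by (simp add: complex_norm_square[symmetric] power2_eq_square flip: of_real_mult)
      moreover have "u \<noteq> 0" using that r by auto
      ultimately have cnj: "cnj (of_real r / u) = u / of_real r"
        using r by (simp add: field_simps)
      then have "K u = 1 + (e * (of_real r / u) ^ n + cnj (e * (of_real r / u) ^ n)) / 2"
        by (simp only: K_def cnj[symmetric] complex_cnj_mult complex_cnj_power)
      also have "\<dots> = of_real (1 + Re (e * (of_real r / u) ^ n))"
        by (simp only: complex_add_cnj) simp
      finally have Ku: "K u = of_real (1 + Re (e * (of_real r / u) ^ n))" .
      have "norm (e * (of_real r / u) ^ n) \<le> 1"
        using that r \<open>norm e \<le> 1\<close> by (simp add: norm_mult norm_power norm_divide)
      then have "- 1 \<le> Re (e * (of_real r / u) ^ n)"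
        using abs_Re_le_cmod[of "e * (of_real r / u) ^ n"] by linarith
      then show "0 \<le> Re (K u)" "Im (K u) = 0" unfolding Ku by simp_all
    qed
    have coeff: "((\<lambda>u. eval_fps h u / (u - 0) ^ Suc k) has_contour_integral (2 * pi * \<i> * h $ k))
        (circlepath 0 r)" for k
    proof -
      have "((\<lambda>u. eval_fps h u / (u - 0) ^ Suc k) has_contour_integral
          (2 * pi * \<i>) / fact k * (deriv ^^ k) (eval_fps h) 0) (circlepath 0 r)"
        by (rule Cauchy_has_contour_integral_higher_derivative_circlepath)
          (use r hol hol' in \<open>auto intro: holomorphic_on_imp_continuous_on\<close>)
      then show ?thesis using fps_nth_conv_deriv[OF rad0, of k] by simp
    qed
    \<comment> \<open>The conjugate half of the kernel, divided by \<open>u\<close>, leaves the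
      holomorphic power \<open>u ^ (n - 1)\<close>, as \<open>0 < n\<close>. The disc of radius
      \<open>(r + 1) / 2\<close> contains the circle and stays inside the unit disc.\<close>
    have pos: "((\<lambda>u. eval_fps h u * u ^ (n - 1)) has_contour_integral 0) (circlepath 0 r)"
    proof (rule Cauchy_theorem_disc_simple[of _ 0 "(r + 1) / 2"])
      have "eball 0 1 \<subseteq> eball (0::complex) (fps_conv_radius h)" using h by (rule eball_mono)
      moreover have "ball 0 ((r + 1) / 2) \<subseteq> eball (0::complex) 1"
        using r by (auto simp: one_ereal_def)
      ultimately show "(\<lambda>u. eval_fps h u * u ^ (n - 1)) holomorphic_on ball 0 ((r + 1) / 2)"
        by (intro holomorphic_intros) auto
    qed (use r in \<open>auto simp: path_image_circlepath\<close>)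
    have "((\<lambda>u. eval_fps h u / (u - 0) ^ Suc 0
         + (e * of_real r ^ n / 2) * (eval_fps h u / (u - 0) ^ Suc n)
         + (cnj e / (2 * of_real r ^ n)) * (eval_fps h u * u ^ (n - 1)))
       has_contour_integral (2 * pi * \<i> * h $ 0 + (e * of_real r ^ n / 2) * (2 * pi * \<i> * h $ n)
         + (cnj e / (2 * of_real r ^ n)) * 0)) (circlepath 0 r)"
      by (intro has_contour_integral_add has_contour_integral_lmul coeff pos)
    also have "2 * pi * \<i> * h $ 0 + (e * of_real r ^ n / 2) * (2 * pi * \<i> * h $ n)
         + (cnj e / (2 * of_real r ^ n)) * 0 = 2 * pi * \<i> * (1 + e * h $ n * of_real r ^ n / 2)"
      by (simp add: h0 algebra_simps)
    finally have "((\<lambda>u. eval_fps h u * K u / u) has_contour_integral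
        (2 * pi * \<i> * (1 + e * h $ n * of_real r ^ n / 2))) (circlepath 0 r)"
    proof (rule has_contour_integral_eq)
      fix u assume "u \<in> path_image (circlepath 0 r)"
      then have "u \<noteq> 0" using r by (auto simp: path_image_circlepath)
      moreover have "u ^ n = u * u ^ (n - 1)"
        using n by (metis power_minus_mult mult.commute)
      ultimately show "eval_fps h u / (u - 0) ^ Suc 0
         + (e * of_real r ^ n / 2) * (eval_fps h u / (u - 0) ^ Suc n)
         + (cnj e / (2 * of_real r ^ n)) * (eval_fps h u * u ^ (n - 1)) = eval_fps h u * K u / u"
        using r by (simp add: K_def field_simps)
    qed
    then have "((\<lambda>x. eval_fps h (circlepath 0 r x) * K (circlepath 0 r x) / circlepath 0 r x
          * vector_derivative (circlepath 0 r) (at x)) has_integral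
        (2 * pi * \<i> * (1 + e * h $ n * of_real r ^ n / 2))) {0..1}"
      by (simp add: has_contour_integral)
    \<comment> \<open>The derivative of the circle path is \<open>2 * pi * \<i>\<close> times the
      path, which cancels the denominator and turns the contour integral into an ordinary mean,
      whose real part has a sign.\<close>
    then have "((\<lambda>x. 2 * pi * \<i> * (eval_fps h (circlepath 0 r x) * K (circlepath 0 r x))) has_integral
        (2 * pi * \<i> * (1 + e * h $ n * of_real r ^ n / 2))) {0..1}"
    proof (rule has_integral_eq[rotated])
      fix x
      have "circlepath 0 r x \<noteq> 0" using r by (simp add: circlepath)
      moreover have "vector_derivative (circlepath 0 r) (at x) = 2 * pi * \<i> * circlepath 0 r x"
        by (simp add: vector_derivative_circlepath) (simp add: circlepath)
      ultimately show "eval_fps h (circlepath 0 r x) * K (circlepath 0 r x) / circlepath 0 r x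
          * vector_derivative (circlepath 0 r) (at x)
        = 2 * pi * \<i> * (eval_fps h (circlepath 0 r x) * K (circlepath 0 r x))"
        by simp
    qed
    from has_integral_mult_right[OF this, of "1 / (2 * pi * \<i>)"]
    have "((\<lambda>x. eval_fps h (circlepath 0 r x) * K (circlepath 0 r x)) has_integral
        (1 + e * h $ n * of_real r ^ n / 2)) {0..1}"
      by simp
    from has_integral_linear[OF this bounded_linear_Re]
    have "((\<lambda>x. Re (eval_fps h (circlepath 0 r x) * K (circlepath 0 r x))) has_integral
        (1 - norm (h $ n) * r ^ n / 2)) {0..1}"
      by (simp add: o_def he flip: of_real_power)
    then have "0 \<le> 1 - norm (h $ n) * r ^ n / 2"
    proof (rule has_integral_nonneg)
      fix x :: real
      have "norm (circlepath 0 r x) = r" using r by (simp add: circlepath norm_mult)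
      then show "0 \<le> Re (eval_fps h (circlepath 0 r x) * K (circlepath 0 r x))"
        using K Re r by simp
    qed
    then show ?thesis by simp
  qed
  have "((\<lambda>r. norm (h $ n) * r ^ n) \<longlongrightarrow> norm (h $ n) * 1 ^ n) (at_left 1)"
    by (intro tendsto_intros)
  moreover have "eventually (\<lambda>r::real. norm (h $ n) * r ^ n \<le> 2) (at_left 1)"
    using eventually_at_left_real[OF zero_less_one] by (rule eventually_mono) (auto intro: bound)
  ultimately show ?thesis
    using tendsto_upperbound[of _ _ "at_left (1::real)"] by force
qed

section \<open>Coefficient bounds\<close>

lemma bounded_linear_qRe: "bounded_linear qRe"
  by (rule bounded_linear_intro[where K = 1])
    (simp_all add: plus_quat_def scaleR_quat_def norm_quat_def real_le_rsqrt)

text \<open>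
  The component of \<open>p\<close> in the slice spanned by \<open>1\<close> and \<open>I\<close>, as a complex number:
  \<open>qRe (I * p)\<close> is minus the \<open>I\<close>-coordinate of \<open>p\<close>.
\<close>
definition slice_part :: "quat \<Rightarrow> quat \<Rightarrow> complex" where
  "slice_part I p = Complex (qRe p) (- qRe (I * p))"

lemma qRe_slice_emb_mult: "qRe (slice_emb I z * p) = Re (z * slice_part I p)"
proof -
  have "slice_emb I z * p = Re z *\<^sub>R p + Im z *\<^sub>R (I * p)"
    by (simp add: slice_emb_eq distrib_right mult.assoc flip: scaleR_conv_of_real)
  then show ?thesis
    by (simp add: plus_quat_def scaleR_quat_def slice_part_def)
qed

lemma slice_part_slice_emb: "I \<in> \<S> \<Longrightarrow> slice_part I (slice_emb I w) = w"
  using slice_emb_mult[of I \<i> w] by (simp add: slice_part_def qRe_slice_emb complex_eq_iff)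
    (metis Re_i_times qRe_slice_emb minus_minus)

text \<open>Multiplying \<open>p\<close> by the embedded conjugate of its slice part gives a
  quaternion whose real part is the squared norm of the slice part; a real part is at most the
  norm.\<close>

lemma norm_slice_part_le:
  assumes "I \<in> \<S>"
  shows "norm (slice_part I p) \<le> norm p"
proof -
  let ?c = "slice_part I p"
  have "norm ?c * norm ?c = Re (cnj ?c * ?c)"
    by (simp add: cmod_def flip: power2_eq_square)
  also have "\<dots> = qRe (slice_emb I (cnj ?c) * p)"
    by (simp add: qRe_slice_emb_mult)
  also have "\<dots> \<le> norm (slice_emb I (cnj ?c) * p)"
    unfolding norm_quat_def by (rule real_le_rsqrt) simp
  also have "\<dots> = norm ?c * norm p"
    by (simp add: norm_mult norm_slice_emb assms)
  finally show ?thesis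
    by (cases "?c = 0") auto
qed

lemma star_act_zero_right [simp]: "star_act f q 0 = 0"
  by (simp add: star_act_def)

text \<open>The slice parts of the coefficients form a complex series whose real part equals that of
  \<open>P\<close> on the slice, so the complex inequality applies.\<close>

lemma star_caratheodory:
  assumes P: "1 \<le> fps_conv_radius P" and P0: "P $ 0 = 1"
    and Re: "\<And>q. norm q < 1 \<Longrightarrow> 0 \<le> qRe (star_act P q 1)" and n: "0 < n"
  shows "norm (P $ n) \<le> 2"
proof -
  \<comment> \<open>In a slice containing \<open>P $ n\<close>, passing to slice parts does not decrease its norm.\<close>
  obtain I w where I: "I \<in> \<S>" and w: "P $ n = slice_emb I w"
    by (rule ex_slice_emb)
  define h where "h = Abs_fps (\<lambda>k. slice_part I (P $ k))"
  have h: "1 \<le> fps_conv_radius h"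
    by (rule order_trans[OF P fps_conv_radius_le_norm]) (simp add: h_def norm_slice_part_le I)
  have "norm (h $ n) \<le> 2"
  proof (rule caratheodory_coeff_bound[OF h _ _ n])
    show "h $ 0 = 1"
      using slice_part_slice_emb[OF I, of 1] by (simp add: h_def P0)
    fix z :: complex assume z: "norm z < 1"
    then have "ereal (norm z) < fps_conv_radius h"
      using less_le_trans[of "ereal (norm z)" 1, OF _ h] by (simp flip: one_ereal_def)
    from bounded_linear.sums[OF bounded_linear_Re sums_eval_fps[OF this]]
    have 1: "(\<lambda>k. Re (z ^ k * slice_part I (P $ k))) sums Re (eval_fps h z)"
      by (simp add: h_def mult.commute)
    have nz: "norm (slice_emb I z) < 1" using z by (simp add: norm_slice_emb I)
    from bounded_linear.sums[OF bounded_linear_qRe star_act_sums[OF P nz, of 1]]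
    have "(\<lambda>k. qRe (slice_emb I (z ^ k) * P $ k)) sums qRe (star_act P (slice_emb I z) 1)"
      by (simp add: slice_emb_power I)
    then have "Re (eval_fps h z) = qRe (star_act P (slice_emb I z) 1)"
      using sums_unique2[OF 1] by (simp only: qRe_slice_emb_mult)
    then show "0 \<le> Re (eval_fps h z)" using Re[OF nz] by simp
  qed
  then show ?thesis
    by (simp add: h_def w slice_part_slice_emb I norm_slice_emb)
qed

lemma star_quotient_coeffs:
  assumes b: "1 \<le> fps_conv_radius b" and c: "1 \<le> fps_conv_radius c"
    and 0: "b $ 0 = 1" "c $ 0 = 1"
    and nz: "\<And>q. norm q < 1 \<Longrightarrow> star_act b q 1 \<noteq> 0"
    and Re: "\<And>q. norm q < 1 \<Longrightarrow> 0 \<le> qRe (inverse (star_act b q 1) * star_act c q 1)"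
  obtains P where "b * P = c" "P $ 0 = 1" "\<And>n. 0 < n \<Longrightarrow> norm (P $ n) \<le> 2"
proof -
  obtain N where N: "1 \<le> fps_conv_radius N" "N * b = 1" "b * N = 1"
    using ex_star_inverse[OF b nz] by blast
  define P where "P = N * c"
  have bP: "b * P = c" by (simp add: P_def N flip: mult.assoc)
  have P0: "P $ 0 = 1" using arg_cong[OF bP, of "\<lambda>f. f $ 0"] 0 by simp
  have P: "1 \<le> fps_conv_radius P"
    unfolding P_def using N c by (intro order_trans[OF _ fps_conv_radius_mult]) simp
  \<comment> \<open>The value of \<open>P\<close> at \<open>q\<close> is the pointwise quotient at a conjugate \<open>q'\<close> of \<open>q\<close>.\<close>
  have "0 \<le> qRe (star_act P q 1)" if q: "norm q < 1" for q
  proof -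
    \<comment> \<open>Acting with \<open>b\<close> on the value \<open>u\<close> of \<open>N\<close>
      evaluates \<open>N * b = 1\<close>, so \<open>u\<close> is nonzero; conjugating by it then
      gives \<open>b\<close> the value \<open>inverse u\<close> at \<open>q'\<close>.\<close>
    define u where "u = star_act N q 1"
    have bu: "star_act b q u = 1"
      by (simp add: u_def star_act_star_act N b q)
    then have u: "u \<noteq> 0" by auto
    define q' where "q' = inverse u * q * u"
    have "norm q' = norm (u * inverse u * q)"
      by (simp only: q'_def norm_mult mult_ac)
    then have q': "norm q' < 1" using u q by simp
    have "u * star_act b q' 1 = 1"
      using bu star_act_conj[OF b q u] by (simp add: q'_def)
    then have "inverse (star_act b q' 1) = u"
      by (metis inverse_unique inverse_inverse_eq)
    moreover have "star_act P q 1 = u * star_act c q' 1"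
      using star_act_conj[OF c q u] star_act_star_act[OF N(1) c q, of 1]
      by (simp add: q'_def P_def u_def)
    ultimately show ?thesis using Re[OF q'] by simp
  qed
  then have "norm (P $ n) \<le> 2" if "0 < n" for n
    by (rule star_caratheodory[OF P P0 _ that])
  with that bP P0 show thesis by blast
qed

text \<open>In the \<open>n\<close>-th coefficient of \<open>b * P = c\<close>, the summand
  \<open>k = n\<close> is \<open>b $ n\<close> and cancels one of the \<open>n + 1\<close> copies on
  the other side. What remains expresses \<open>n * b $ n\<close> by earlier coefficients, and
  induction gives \<open>n * norm (b $ n) \<le> 2 * (1 + ... + n)\<close>.\<close>

lemma starlike_coeff_bound:
  fixes b :: "quat fps"
  defines "c \<equiv> fps_deriv (fps_X * b)"
  assumes b: "1 \<le> fps_conv_radius b" and b0: "b $ 0 = 1"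
    and nz: "\<And>q. norm q < 1 \<Longrightarrow> star_act b q 1 \<noteq> 0"
    and Re: "\<And>q. norm q < 1 \<Longrightarrow> 0 \<le> qRe (inverse (star_act b q 1) * star_act c q 1)"
  shows "norm (b $ n) \<le> real (Suc n)"
proof -
  have c_nth: "c $ n = of_nat (Suc n) * b $ n" for n
    by (simp add: c_def distrib_right add.commute)
  have "1 \<le> fps_conv_radius (fps_X * b)"
    by (rule order_trans[OF _ fps_conv_radius_mult]) (simp add: b)
  then have c: "1 \<le> fps_conv_radius c"
    unfolding c_def using fps_conv_radius_deriv_norm order_trans by blast
  obtain P where P: "b * P = c" "P $ 0 = 1" "\<And>n. 0 < n \<Longrightarrow> norm (P $ n) \<le> 2"
    using star_quotient_coeffs[OF b c b0 _ nz Re] c_nth[of 0] b0 by auto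
  show ?thesis
  proof (induction n rule: less_induct)
    case (less n)
    show ?case
    proof (cases "n = 0")
      case False
      have "of_nat (Suc n) * b $ n = (\<Sum>k<n. b $ k * P $ (n - k)) + b $ n"
        using arg_cong[OF P(1), of "\<lambda>f. f $ n"]
        by (simp add: c_nth fps_mult_nth P(2) atLeast0AtMost lessThan_Suc_atMost[symmetric]
            del: of_nat_Suc)
      moreover have "of_nat (Suc n) * b $ n = of_nat n * b $ n + b $ n"
        by (simp only: of_nat_Suc distrib_right mult_1_left add.commute)
      ultimately have "of_nat n * b $ n = (\<Sum>k<n. b $ k * P $ (n - k))"
        by (metis add_right_cancel)
      then have "real n * norm (b $ n) = norm (\<Sum>k<n. b $ k * P $ (n - k))"
        by (metis norm_mult norm_of_nat)
      also have "\<dots> \<le> (\<Sum>k<n. real (Suc k) * 2)"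
        by (rule sum_norm_le)
          (simp add: norm_mult del: of_nat_Suc, intro mult_mono less.IH P, auto)
      also have "\<dots> = real n * real (Suc n)"
        by (induction n) (simp_all add: algebra_simps)
      finally show ?thesis using False by (simp del: of_nat_Suc)
    qed (simp add: b0)
  qed
qed

section \<open>From admissible functions to coefficient bounds\<close>

lemma has_derivative_slice_star_act:
  assumes F: "1 \<le> fps_conv_radius F" and f: "\<And>q. norm q < 1 \<Longrightarrow> f q = star_act F q 1"
    and I: "I \<in> \<S>" and z: "norm z < 1"
  shows "((\<lambda>z. f (slice_emb I z)) has_derivative
    (\<lambda>h. slice_emb I h * star_act (fps_deriv F) (slice_emb I z) 1)) (at z)"
  by (rule has_derivative_transform_within_open
        [OF star_act_slice_has_derivative[OF F I z], of "ball 0 1"])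
    (use z in \<open>auto simp: f norm_slice_emb I\<close>)

lemma slice_deriv_star_act:
  assumes "1 \<le> fps_conv_radius F" "\<And>q. norm q < 1 \<Longrightarrow> f q = star_act F q 1" "norm q < 1"
  shows "slice_deriv f q = star_act (fps_deriv F) q 1"
  by (rule slice_deriv_eq[OF has_derivative_slice_star_act[OF assms(1,2)]])
    (use assms(3) in \<open>auto simp: unit_ball_def\<close>)

text \<open>The first factor acts first and produces \<open>q\<close>; conjugating \<open>q\<close>
  by itself changes nothing, so this star product is the pointwise one.\<close>

lemma star_act_fps_X_mult:
  assumes "1 \<le> fps_conv_radius f" "norm q < 1"
  shows "star_act (fps_X * f) q 1 = q * star_act f q 1"
proof -
  have X: "star_act fps_X q 1 = q"
    unfolding star_act_def by (subst suminf_finite[of "{1}"]) auto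
  have "star_act (fps_X * f) q 1 = star_act f q q"
    using star_act_star_act[of fps_X f q 1] assms by (simp add: X)
  then show ?thesis
    using star_act_conj[OF assms, of q] by (cases "q = 0") simp_all
qed

lemma admissible_coeff_bound:
  assumes adm: "admissible f p"
  shows "norm (p (k + 2)) \<le> 1"
proof -
  \<comment> \<open>The first two coefficients are those of \<open>q\<close>, so that
    \<open>F\<close> is the full expansion of \<open>f\<close>.\<close>
  define F where "F = Abs_fps (\<lambda>k. if k = 0 then 0 else if k = 1 then 1 else p k)"
  have sums: "(\<lambda>k. q ^ k * 1 * F $ k) sums f q" if "norm q < 1" for q
  proof -
    have "(\<lambda>k. q ^ (k + 2) * 1 * F $ (k + 2)) sums (f q - q)"
      using adm that by (simp add: admissible_def unit_ball_def F_def)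
    then show ?thesis
      by (subst (asm) sums_iff_shift) (simp add: F_def numeral_2_eq_2)
  qed
  have F: "1 \<le> fps_conv_radius F"
    unfolding fps_conv_radius_def
  proof (rule conv_radius_geI_ex')
    fix r :: real assume "0 < r" "ereal r < 1"
    \<comment> \<open>Convergence at real points below 1 already determines the radius, and real
      powers commute with the coefficients.\<close>
    then have "summable (\<lambda>k. (of_real r :: quat) ^ k * 1 * F $ k)"
      by (intro sums_summable[OF sums]) (simp flip: one_ereal_def)
    then show "summable (\<lambda>k. F $ k * of_real r ^ k)"
      by (simp add: scaleR_conv_of_real[symmetric] flip: of_real_power)
        (simp add: of_real_def)
  qed
  define b where "b = fps_deriv F"
  have b: "1 \<le> fps_conv_radius b"
    unfolding b_def using F fps_conv_radius_deriv_norm order_trans by blast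
  have Xb: "1 \<le> fps_conv_radius (fps_X * b)"
    by (rule order_trans[OF _ fps_conv_radius_mult]) (simp add: b)
  have f: "f q = star_act F q 1" if "norm q < 1" for q
    using sums[OF that] by (simp add: star_act_def sums_iff)
  have f': "slice_deriv f q = star_act b q 1" if "norm q < 1" for q
    unfolding b_def by (rule slice_deriv_star_act[OF F f that])
  let ?g = "\<lambda>q. q * slice_deriv f q"
  have g: "?g q = star_act (fps_X * b) q 1" if "norm q < 1" for q
    by (simp add: star_act_fps_X_mult b f' that)
  have g': "slice_deriv ?g q = star_act (fps_deriv (fps_X * b)) q 1" if "norm q < 1" for q
    by (rule slice_deriv_star_act[OF Xb g that])
  have S: "?g \<in> slice_starlike" using adm by (simp add: admissible_def)
  have b0: "b $ 0 = 1" by (simp add: b_def F_def)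
  have nz: "star_act b q 1 \<noteq> 0" if q: "norm q < 1" for q
  \<comment> \<open>Away from 0 the zero condition on \<open>q * slice_deriv f q\<close> applies; at
    0 it gives no information on the second factor, whose value there is
    \<open>b $ 0 = 1\<close>.\<close>
  proof (cases "q = 0")
    case False
    have "{q \<in> \<bool>. ?g q = 0} = {0}" using S by (simp add: slice_starlike_def class_S_def)
    then have "?g q \<noteq> 0" using False q by (auto simp: unit_ball_def)
    then show ?thesis using f'[OF q] by auto
  qed (simp add: b0)
  have "norm (b $ Suc k) \<le> real (Suc (Suc k))"
  proof (rule starlike_coeff_bound[OF b b0 nz])
    fix q :: quat assume q: "norm q < 1"
    show "0 \<le> qRe (inverse (star_act b q 1) * star_act (fps_deriv (fps_X * b)) q 1)"
    proof (cases "q = 0")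
      case False
      have "0 < qRe (starlike_quotient ?g q)"
        using S q by (auto simp: slice_starlike_def unit_ball_def)
      also have "starlike_quotient ?g q = inverse (?g q) * q * slice_deriv ?g q"
        using False by (simp add: starlike_quotient_def)
      also have "inverse (?g q) * q = inverse (star_act b q 1)"
        using False nz[OF q] by (simp add: f' q nonzero_inverse_mult_distrib mult.assoc)
      finally show ?thesis by (simp add: g' q)
    qed (simp add: b0, simp add: one_quat_def)
  qed
  moreover have "b $ Suc k = of_nat (Suc (Suc k)) * p (k + 2)"
    by (simp add: b_def F_def)
  ultimately show ?thesis
    by (simp add: norm_mult del: of_nat_Suc)
qed

section \<open>The extremal function\<close>

text \<open>Functions that preserve a slice can be differentiated there as complex
  functions.\<close>

lemma has_derivative_slice_emb:
  assumes I: "I \<in> \<S>" and F: "(F has_field_derivative F') (at z)"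
    and S: "open S" "z \<in> S" "\<And>w. w \<in> S \<Longrightarrow> f (slice_emb I w) = slice_emb I (F w)"
  shows "((\<lambda>w. f (slice_emb I w)) has_derivative (\<lambda>h. slice_emb I h * slice_emb I F')) (at z)"
proof -
  have "((\<lambda>w. slice_emb I (F w)) has_derivative (\<lambda>h. slice_emb I (F' * h))) (at z)"
    using F unfolding has_field_derivative_def
    by (rule bounded_linear.has_derivative[OF bounded_linear_slice_emb[OF I]])
  then have "((\<lambda>w. slice_emb I (F w)) has_derivative (\<lambda>h. slice_emb I h * slice_emb I F')) (at z)"
    by (simp add: slice_emb_mult[OF I, symmetric] mult.commute)
  then show ?thesis
    by (rule has_derivative_transform_within_open[OF _ S(1,2)]) (simp add: S(3))
qed

text \<open>The real part is \<open>(1 - (norm z)^2) / (norm (1 - z))^2\<close>.\<close>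

lemma Re_cayley_pos:
  assumes "norm (z::complex) < 1"
  shows "0 < Re ((1 + z) * inverse (1 - z))"
proof -
  have z1: "1 - z \<noteq> 0" using assms by auto
  have "(norm z)\<^sup>2 < 1" using assms by (simp add: power_less_one_iff)
  then have "0 < Re ((1 + z) * cnj (1 - z))"
    by (simp add: cmod_power2) (simp add: algebra_simps power2_eq_square)
  then have "0 < Re ((1 + z) * cnj (1 - z)) / (norm (1 - z))\<^sup>2"
    using z1 by simp
  also have "\<dots> = Re ((1 + z) * inverse (1 - z))"
    by (simp add: complex_div_cnj[of "1 + z"] Re_divide_of_real flip: divide_inverse of_real_power)
  finally show ?thesis .
qed

text \<open>Here \<open>q f'(q)\<close> is the Koebe function \<open>q (1 - q)^-2\<close>, whose
  starlike quotient is the Cayley transform \<open>(1 + q) (1 - q)^-1\<close>. All of these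
  functions preserve every slice, so the computations are complex ones.\<close>

lemma admissible_extremal: "admissible (\<lambda>q. q * inverse (1 - q)) (\<lambda>_. 1)"
proof -
  define f :: "quat \<Rightarrow> quat" where "f = (\<lambda>q. q * inverse (1 - q))"
  define g where "g = (\<lambda>q. q * slice_deriv f q)"
  define D1 :: "quat \<Rightarrow> quat" where "D1 q = inverse ((1 - q)\<^sup>2)" for q
  define D2 :: "quat \<Rightarrow> quat" where "D2 q = (1 + q) * inverse ((1 - q) ^ 3)" for q
  note emb = slice_emb_mult slice_emb_diff slice_emb_add slice_emb_inverse slice_emb_power
  have ne1: "1 - q \<noteq> 0" if "q \<in> \<bool>" for q :: quat
    using that by (auto simp: unit_ball_def)
  have z1: "1 - z \<noteq> 0" if "norm z < 1" for z :: complex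
    using that by auto
  have f_emb: "f (slice_emb I z) = slice_emb I (z * inverse (1 - z))" if "I \<in> \<S>" for I z
    using that by (simp add: f_def emb)
  have f': "((\<lambda>z. f (slice_emb I z)) has_derivative (\<lambda>h. slice_emb I h * D1 (slice_emb I z))) (at z)"
    if I: "I \<in> \<S>" and z: "norm z < 1" for I z
  proof -
    have "((\<lambda>z. z * inverse (1 - z)) has_field_derivative inverse ((1 - z)\<^sup>2)) (at z)"
      using z1[OF z] by (auto intro!: derivative_eq_intros simp: power2_eq_square field_simps)
    from has_derivative_slice_emb[OF I this open_UNIV UNIV_I f_emb[OF I]]
    show ?thesis using I by (simp add: D1_def emb)
  qed
  have df: "slice_deriv f q = D1 q" if "q \<in> \<bool>" for q
    using f' that by (rule slice_deriv_eq)
  have g: "g q = q * D1 q" if "q \<in> \<bool>" for q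
    using df[OF that] by (simp add: g_def)
  have g': "((\<lambda>z. g (slice_emb I z)) has_derivative (\<lambda>h. slice_emb I h * D2 (slice_emb I z))) (at z)"
    if I: "I \<in> \<S>" and z: "norm z < 1" for I z
  proof -
    have "((\<lambda>z. z * inverse ((1 - z)\<^sup>2)) has_field_derivative (1 + z) * inverse ((1 - z) ^ 3)) (at z)"
    proof -
      \<comment> \<open>Writing everything in \<open>w\<close> turns the denominators into
        monomials.\<close>
      define w where "w = 1 - z"
      then have w: "z = 1 - w" "w \<noteq> 0" using z1[OF z] by auto
      show ?thesis
        unfolding w(1) using w(2)
        by (auto intro!: derivative_eq_intros simp: power2_eq_square power3_eq_cube field_simps)
    qed
    from has_derivative_slice_emb[OF I this open_ball[of 0 1]]
    show ?thesis
      using I z by (simp add: D1_def D2_def emb g slice_emb_in_ball_iff)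
  qed
  have dg: "slice_deriv g q = D2 q" if "q \<in> \<bool>" for q
    using g' that by (rule slice_deriv_eq)
  have reg: "slice_regular f"
    by (rule slice_regularI[OF f'])
      (auto simp: D1_def intro!: continuous_intros dest: ne1)
  have reg': "slice_regular g"
    by (rule slice_regularI[OF g'])
      (auto simp: D2_def intro!: continuous_intros dest: ne1)
  have zeros: "{q \<in> \<bool>. g q = 0} = {0}"
    using ne1 by (auto simp: g D1_def) (auto simp: unit_ball_def g_def)
  have "0 < qRe (starlike_quotient g q)" if q: "q \<in> \<bool>" for q
  proof (cases "q = 0")
    case False
    obtain I z where I: "I \<in> \<S>" and qz: "q = slice_emb I z" by (rule ex_slice_emb)
    have z: "norm z < 1" "z \<noteq> 0" using q False I by (auto simp: qz slice_emb_in_ball_iff)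
    have "starlike_quotient g q = inverse (q * D1 q) * q * D2 q"
      using False q by (simp add: starlike_quotient_def g dg)
    also have "\<dots> = slice_emb I (inverse (z * inverse ((1 - z)\<^sup>2)) * z *
        ((1 + z) * inverse ((1 - z) ^ 3)))"
      unfolding D1_def D2_def qz
      by (simp only: slice_emb_mult[OF I] slice_emb_inverse[OF I] slice_emb_power[OF I]
          slice_emb_diff slice_emb_add slice_emb_simps)
    also have "inverse (z * inverse ((1 - z)\<^sup>2)) * z * ((1 + z) * inverse ((1 - z) ^ 3)) =
        (1 + z) * inverse (1 - z)"
    proof -
      have "inverse (z * inverse (w\<^sup>2)) * z * ((1 + z) * inverse (w ^ 3)) = (1 + z) * inverse w"
        if "w \<noteq> 0" for w
        using z that by (simp add: field_simps power2_eq_square power3_eq_cube)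
      then show ?thesis using z1[OF z(1)] .
    qed
    finally show ?thesis
      using I Re_cayley_pos[OF z(1)] by (simp add: qRe_slice_emb)
  qed (simp add: starlike_quotient_def one_quat_def)
  moreover have "g 0 = 0" by (simp add: g_def)
  moreover have "slice_deriv g 0 = 1" by (simp add: dg D2_def unit_ball_def)
  ultimately have star: "g \<in> slice_starlike"
    using reg' zeros by (simp add: slice_starlike_def class_S_def)
  have "(\<lambda>k. q ^ (k + 2) * 1) sums (f q - q)" if q: "q \<in> \<bool>" for q
  proof -
    obtain I z where I: "I \<in> \<S>" and qz: "q = slice_emb I z" by (rule ex_slice_emb)
    have z: "norm z < 1" using q I by (simp add: qz slice_emb_in_ball_iff)
    have "(\<lambda>k. z ^ (k + 2)) sums (1 / (1 - z) * z\<^sup>2)"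
      unfolding power_add by (intro sums_mult2 geometric_sums z)
    also have "1 / (1 - z) * z\<^sup>2 = z * inverse (1 - z) - z"
      using z1[OF z] by (simp add: field_simps power2_eq_square)
    finally have "(\<lambda>k. slice_emb I (z ^ (k + 2))) sums slice_emb I (z * inverse (1 - z) - z)"
      by (rule bounded_linear.sums[OF bounded_linear_slice_emb[OF I]])
    then show ?thesis
      by (simp only: mult_1_right qz slice_emb_power[OF I] f_emb[OF I] slice_emb_diff)
  qed
  with reg star show ?thesis
    by (simp add: admissible_def g_def flip: f_def)
qed

text \<open>Since the coefficients have norm at most 1, the sum is at most
  \<open>t + t^2 / (1 - t) = t / (1 - t)\<close> with \<open>t = norm q\<close>, and this is at most
  1 exactly up to \<open>t = 1/2\<close>; the extremal function attains it. Summability accompanies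
  each inequality because the sum of a divergent series is an unspecified value.\<close>

theorem theorem1p2:
  shows "(\<forall>f p. admissible f p \<longrightarrow>
            (\<forall>q\<in>\<bool>. norm q \<le> 1/2 \<longrightarrow>
               summable (\<lambda>k. norm (q ^ (k + 2) * p (k + 2))) \<and>
               norm q + (\<Sum>k. norm (q ^ (k + 2) * p (k + 2))) \<le> 1)) \<and>
         (\<forall>r::real. r > 1/2 \<longrightarrow>
            (\<exists>f p. admissible f p \<and>
               (\<exists>q\<in>\<bool>. norm q \<le> r \<and>
                  summable (\<lambda>k. norm (q ^ (k + 2) * p (k + 2))) \<and>
                  norm q + (\<Sum>k. norm (q ^ (k + 2) * p (k + 2))) > 1)))"
proof (intro conjI allI impI ballI)
  have geom: "(\<lambda>k. t ^ (k + 2)) sums (t\<^sup>2 / (1 - t))" if "0 \<le> t" "t < 1" for t :: real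
    using sums_mult2[OF geometric_sums[of t], of "t\<^sup>2"] that
    by (simp only: power_add) simp
  {
    fix f p q assume adm: "admissible f p" and q: "norm (q::quat) \<le> 1/2"
    let ?t = "norm q"
    have le: "norm (q ^ (k + 2) * p (k + 2)) \<le> ?t ^ (k + 2)" for k
      using mult_left_mono[OF admissible_coeff_bound[OF adm, of k], of "?t ^ (k + 2)"]
      by (simp add: norm_mult norm_power)
    have g: "(\<lambda>k. ?t ^ (k + 2)) sums (?t\<^sup>2 / (1 - ?t))" using q by (intro geom) auto
    show *: "summable (\<lambda>k. norm (q ^ (k + 2) * p (k + 2)))"
      by (rule summable_comparison_test'[OF sums_summable[OF g], of 0]) (use le in simp)
    have "(\<Sum>k. norm (q ^ (k + 2) * p (k + 2))) \<le> ?t\<^sup>2 / (1 - ?t)"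
      using suminf_le[OF le * sums_summable[OF g]] g by (simp add: sums_iff)
    moreover have "?t + ?t\<^sup>2 / (1 - ?t) = ?t / (1 - ?t)"
      using q by (simp add: field_simps power2_eq_square)
    moreover have "?t / (1 - ?t) \<le> 1" using q by (simp add: field_simps)
    ultimately show "?t + (\<Sum>k. norm (q ^ (k + 2) * p (k + 2))) \<le> 1" by linarith
  }
  fix r :: real assume r: "r > 1/2"
  \<comment> \<open>The cap \<open>3/4\<close>, any number strictly between 1/2 and 1, keeps the
    witness inside the ball when \<open>r\<close> is large.\<close>
  define t where "t = min r (3/4)"
  have t: "1/2 < t" "t < 1" "t \<le> r" using r by (auto simp: t_def)
  have g: "(\<lambda>k. norm ((of_real t :: quat) ^ (k + 2) * 1)) sums (t\<^sup>2 / (1 - t))"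
    using geom[of t] t by (simp add: norm_mult norm_power)
  have "t + t\<^sup>2 / (1 - t) = t / (1 - t)"
    using t by (simp add: field_simps power2_eq_square)
  moreover have "1 < t / (1 - t)" using t by (simp add: field_simps)
  ultimately have "norm (of_real t :: quat) +
      (\<Sum>k. norm ((of_real t :: quat) ^ (k + 2) * 1)) > 1"
    using sums_unique[OF g] t by simp
  then show "\<exists>f p. admissible f p \<and> (\<exists>q\<in>\<bool>. norm q \<le> r \<and>
      summable (\<lambda>k. norm (q ^ (k + 2) * p (k + 2))) \<and>
      norm q + (\<Sum>k. norm (q ^ (k + 2) * p (k + 2))) > 1)"
    using t sums_summable[OF g]
    by (intro exI[of _ "\<lambda>q. q * inverse (1 - q)"] exI[of _ "\<lambda>_. 1"] conjI admissible_extremal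
        bexI[of _ "of_real t"]) (auto simp: unit_ball_def)
qed

end
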